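(* Let $\lambda_0$ be an eigenvalue of finite multiplicity $m$, at $(\mu_0,\varepsilon_0)\in X\times Y$, of the problem "find $(u,\lambda)\in V\times\mathbb{R}$, $u\ne0$, with $a(u,v;\mu)=\lambda\,b(u,v;\varepsilon)$ for all $v\in V$", with $b(\cdot,\cdot\,;\varepsilon_0)$-orthonormal eigenbasis $\mathbf{u}_0\in V^m$, and set $\boldsymbol\lambda_0=\lambda_0\mathbf{I}$. Let $(\mu,\varepsilon)\mapsto(\mathbf{u},\boldsymbol\lambda)\in V^m\times\mathbb{R}^{m\times m}$ be the unique local, analytic trajectory such that $(\mathbf{u},\boldsymbol\lambda)$ satisfies $$a(\mathbf{u},\mathbf{v};\mu)=b(\mathbf{u},\mathbf{v};\varepsilon)\cdot\boldsymbol\lambda\ \text{ for all }\mathbf{v}\in V^m,\qquad b(\mathbf{u},\mathbf{u};\varepsilon)=\mathbf{I},$$ with random coefficients $\mu(\omega,\alpha)=\mu_0+\alpha\mu_1(\omega)$, $\varepsilon(\omega,\beta)=\varepsilon_0+\beta\varepsilon_1(\omega)$, and such that $(\mathbf{u},\boldsymbol\lambda)=(\mathbf{u}_0,\lambda_0\mathbf{I})$ at $(\mu_0,\varepsilon_0)$. Then it holds $$\mathbb{E}[\boldsymbol\lambda]=\boldsymbol\lambda_0+\mathcal{O}\big((|\alpha|+|\beta|)^2\big),\qquad \mathbb{E}[\mathbf{u}]=\mathbf{u}_0+\mathcal{O}\big((|\alpha|+|\beta|)^2\big),$$ $$\mathrm{Cov}[\boldsymbol\lambda]=\alpha^2\,\mathrm{Cov}\big[D_{(0,0)}^{(1,0)}\boldsymbol\lambda\big]+\beta^2\,\mathrm{Cov}\big[D_{(0,0)}^{(0,1)}\boldsymbol\lambda\big]+\mathcal{O}\big((|\alpha|+|\beta|)^3\big),$$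 $$\mathrm{Cov}[\mathbf{u}]=\alpha^2\,\mathrm{Cov}\big[D_{(0,0)}^{(1,0)}\mathbf{u}\big]+\beta^2\,\mathrm{Cov}\big[D_{(0,0)}^{(0,1)}\mathbf{u}\big]+\mathcal{O}\big((|\alpha|+|\beta|)^3\big).$$
   Context: $V,H$ are real Hilbert spaces with dense and compact embedding $V\hookrightarrow H$; $X,Y$ are Banach spaces. For a Hilbert space $U$, $B(U)$ is the Banach space of continuous bilinear forms on $U$ with the operator norm. The forms depend linearly and continuously on the parameters: $a\in\mathcal{L}(X;B(V))$, $b\in\mathcal{L}(Y;B(H))$. For all parameters under consideration, $a(\cdot,\cdot\,;\mu)$ is a continuous, $V$-elliptic, symmetric bilinear form on $V$ and $b(\cdot,\cdot\,;\varepsilon)$ is a continuous, $H$-elliptic scalar product on $H$. Elements of $V^m$ are row vectors $\mathbf{u}=[[\mathbf{u}]_1,\dots,[\mathbf{u}]_m]$. For $\mathbf{u},\mathbf{v}\in V^m$, $a(\mathbf{u},\mathbf{v};\mu)\in\mathbb{R}^{m\times m}$ has $(i,j)$ entry $a([\mathbf{u}]_j,[\mathbf{v}]_i;\mu)$; likewise for $b$. $\mathbf{I}$ is the identity matrix. Stochastic model: $(\Omega,\mathcal{A},\mathbb{P})$ is a probability space; $\alpha\in(-\alpha_0,\alpha_0)$, $\beta\in(-\beta_0,\beta_0)$ are real; $\mu_1\in L^2_{\mathbb{P}}(\Omega;X)$ and $\varepsilon_1\in L^2_{\mathbb{P}}(\Omega;Y)$ are uncorrelated and centered, with $\|\mu_1\|_X\le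 C_\mu<\infty$ and $\|\varepsilon_1\|_Y\le C_\varepsilon<\infty$ $\mathbb{P}$-a.s., and $\alpha_0,\beta_0>0$ are chosen sufficiently small that the eigenvalue problem is solvable for all such $\alpha,\beta$. $D_{(0,0)}^{(1,0)}$ and $D_{(0,0)}^{(0,1)}$ denote the ($\omega$-wise) derivatives at $(\alpha,\beta)=(0,0)$ in directions $(1,0)$ and $(0,1)$ of quantities viewed as functions of $(\alpha,\beta)$. For random fields $z_i\in L^2_{\mathbb{P}}(\Omega;Z_i)$ with Hilbert spaces $Z_i$, $\mathbb{E}[z_1]=\int_\Omega z_1\,\mathrm{d}\mathbb{P}$, $\mathrm{Cov}[z_1,z_2]=\mathbb{E}[(z_1-\mathbb{E}[z_1])\otimes(z_2-\mathbb{E}[z_2])]\in Z_1\otimes Z_2$ (Hilbertian tensor product) and $\mathrm{Cov}[z_1]=\mathrm{Cov}[z_1,z_1]$. The Landau symbols are for $\alpha,\beta\to0$. *)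

theory Defs
  imports "HOL-Probability.Probability" "HOL-Library.Landau_Symbols"
begin

section \<open>Expectation, second moments and covariance\<close>

text \<open>
  The Bochner integral of HOL-Analysis is restricted to second countable spaces, and it asks for
  genuine measurability of the integrand. Here it is needed for arbitrary Banach spaces and for
  random variables that are only determined almost surely, so the textbook definition is used:
  strong measurability and approximation in mean by simple functions. The two notions agree
  wherever both apply, see \<open>bochner_mean_eq_lebesgue_integral\<close> below.
\<close>

definition strongly_measurable :: "'w measure \<Rightarrow> ('w \<Rightarrow> 'z::real_normed_vector) \<Rightarrow> bool" where
  "strongly_measurable M f \<longleftrightarrow>
    (\<exists>s. (\<forall>i::nat. simple_function M (s i)) \<and> (AE \<omega> in M. (\<lambda>i. s i \<omega>) \<longlonglongrightarrow> f \<omega>))"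

definition has_bochner_mean :: "'w measure \<Rightarrow> ('w \<Rightarrow> 'z::real_normed_vector) \<Rightarrow> 'z \<Rightarrow> bool" where
  "has_bochner_mean M f x \<longleftrightarrow>
    strongly_measurable M f \<and>
    (\<exists>s. (\<forall>i::nat. Bochner_Integration.simple_bochner_integrable M (s i)) \<and>
      (\<lambda>i. \<integral>\<^sup>+\<omega>. ennreal (norm (f \<omega> - s i \<omega>)) \<partial>M) \<longlonglongrightarrow> 0 \<and>
      (\<lambda>i. Bochner_Integration.simple_bochner_integral M (s i)) \<longlonglongrightarrow> x)"

definition bochner_mean :: "'w measure \<Rightarrow> ('w \<Rightarrow> 'z::real_normed_vector) \<Rightarrow> 'z" where
  "bochner_mean M f = (THE x. has_bochner_mean M f x)"

definition in_L2 :: "'w measure \<Rightarrow> ('w \<Rightarrow> 'z::real_normed_vector) \<Rightarrow> bool" where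
  "in_L2 M f \<longleftrightarrow> strongly_measurable M f \<and> (\<integral>\<^sup>+\<omega>. ennreal ((norm (f \<omega>))\<^sup>2) \<partial>M) < \<infinity>"

definition centered :: "'w measure \<Rightarrow> ('w \<Rightarrow> 'z::real_normed_vector) \<Rightarrow> bool" where
  "centered M f \<longleftrightarrow> has_bochner_mean M f 0"

text \<open>
  Banach spaces have no canonical tensor product in which a cross covariance could be formed;
  being uncorrelated is expressed through the scalar covariances against all continuous linear
  functionals. For Hilbert spaces this says that the covariance in the tensor product vanishes.
\<close>

definition uncorrelated ::
    "'w measure \<Rightarrow> ('w \<Rightarrow> 'x::real_normed_vector) \<Rightarrow> ('w \<Rightarrow> 'y::real_normed_vector) \<Rightarrow> bool" where
  "uncorrelated M f g \<longleftrightarrow>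
    (\<forall>(\<phi> :: 'x \<Rightarrow>\<^sub>L real) (\<psi> :: 'y \<Rightarrow>\<^sub>L real).
      has_bochner_mean M
        (\<lambda>\<omega>. blinfun_apply \<phi> (f \<omega> - bochner_mean M f) * blinfun_apply \<psi> (g \<omega> - bochner_mean M g)) 0)"

text \<open>
  The Hilbertian tensor product of two Hilbert spaces is determined up to isometric isomorphism:
  it is a Hilbert space in which the elementary tensors have the product inner product and span a
  dense subspace, i.e. the completion of the algebraic tensor product.
\<close>

definition hilbert_tensor_product ::
    "('z1::{real_inner,banach} \<Rightarrow> 'z2::{real_inner,banach} \<Rightarrow> 't::{real_inner,banach}) \<Rightarrow> bool" where
  "hilbert_tensor_product ten \<longleftrightarrow>
    bilinear ten \<and>
    (\<forall>x y x' y'. inner (ten x y) (ten x' y') = inner x x' * inner y y') \<and>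
    closure (span (range (\<lambda>(x, y). ten x y))) = UNIV"

definition cov :: "('z1::{real_inner,banach} \<Rightarrow> 'z2::{real_inner,banach} \<Rightarrow> 't::{real_inner,banach})
    \<Rightarrow> 'w measure \<Rightarrow> ('w \<Rightarrow> 'z1) \<Rightarrow> ('w \<Rightarrow> 'z2) \<Rightarrow> 't" where
  "cov ten M f g = bochner_mean M (\<lambda>\<omega>. ten (f \<omega> - bochner_mean M f) (g \<omega> - bochner_mean M g))"


section \<open>Analytic maps between normed spaces\<close>

text \<open>
  Local expansion into a power series of bounded multilinear maps with positive radius of
  convergence. The \<open>k\<close>-linear coefficient is the restriction of \<open>A\<close> to lists of length \<open>k\<close>, and
  \<open>C k\<close> bounds its norm.
\<close>

definition real_analytic_at :: "('p::real_normed_vector \<Rightarrow> 'q::real_normed_vector) \<Rightarrow> 'p \<Rightarrow> bool" where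
  "real_analytic_at f p \<longleftrightarrow>
    (\<exists>(A :: 'p list \<Rightarrow> 'q) (C :: nat \<Rightarrow> real) r.
      0 < r \<and>
      (\<forall>hs i. i < length hs \<longrightarrow> linear (\<lambda>h. A (hs[i := h]))) \<and>
      (\<forall>k. 0 \<le> C k) \<and>
      (\<forall>hs. norm (A hs) \<le> C (length hs) * prod_list (map norm hs)) \<and>
      summable (\<lambda>k. C k * r ^ k) \<and>
      (\<forall>h. norm h < r \<longrightarrow> (\<lambda>k. A (replicate k h)) sums f (p + h)))"

definition real_analytic_on :: "('p::real_normed_vector \<Rightarrow> 'q::real_normed_vector) \<Rightarrow> 'p set \<Rightarrow> bool" where
  "real_analytic_on f N \<longleftrightarrow> (\<forall>p\<in>N. real_analytic_at f p)"

definition directional_derivative ::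
    "('p::real_normed_vector \<Rightarrow> 'q::real_normed_vector) \<Rightarrow> 'p \<Rightarrow> 'p \<Rightarrow> 'q" where
  "directional_derivative f p d = vector_derivative (\<lambda>t. f (p + t *\<^sub>R d)) (at 0)"


section \<open>The eigenvalue problem\<close>

definition dense_compact_embedding :: "('v::real_normed_vector \<Rightarrow>\<^sub>L 'h::real_normed_vector) \<Rightarrow> bool" where
  "dense_compact_embedding \<iota> \<longleftrightarrow>
    inj (blinfun_apply \<iota>) \<and>
    closure (range (blinfun_apply \<iota>)) = UNIV \<and>
    compact (closure (blinfun_apply \<iota> ` ball 0 1))"

abbreviation bilinear_form ::
    "('u::real_normed_vector \<Rightarrow>\<^sub>L 'u \<Rightarrow>\<^sub>L real) \<Rightarrow> 'u \<Rightarrow> 'u \<Rightarrow> real" where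
  "bilinear_form q u v \<equiv> blinfun_apply (blinfun_apply q u) v"

definition symmetric_form :: "('u::real_normed_vector \<Rightarrow>\<^sub>L 'u \<Rightarrow>\<^sub>L real) \<Rightarrow> bool" where
  "symmetric_form q \<longleftrightarrow> (\<forall>u v. bilinear_form q u v = bilinear_form q v u)"

definition elliptic_form :: "('u::real_normed_vector \<Rightarrow>\<^sub>L 'u \<Rightarrow>\<^sub>L real) \<Rightarrow> bool" where
  "elliptic_form q \<longleftrightarrow> (\<exists>c>0. \<forall>u. c * (norm u)\<^sup>2 \<le> bilinear_form q u u)"

definition eigenspace :: "('v \<Rightarrow> 'v \<Rightarrow> real) \<Rightarrow> ('v \<Rightarrow> 'v \<Rightarrow> real) \<Rightarrow> real \<Rightarrow> 'v set" where
  "eigenspace A B l = {u. \<forall>v. A u v = l * B u v}"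

definition eigenvalue :: "('v::zero \<Rightarrow> 'v \<Rightarrow> real) \<Rightarrow> ('v \<Rightarrow> 'v \<Rightarrow> real) \<Rightarrow> real \<Rightarrow> bool" where
  "eigenvalue A B l \<longleftrightarrow> (\<exists>u. u \<noteq> 0 \<and> (\<forall>v. A u v = l * B u v))"

text \<open>Note the order of the indices: row \<open>i\<close> belongs to the test vector \<open>v\<close>.\<close>

definition matrix_form :: "('v \<Rightarrow> 'v \<Rightarrow> real) \<Rightarrow> 'v^'m \<Rightarrow> 'v^'m \<Rightarrow> real^'m^'m" where
  "matrix_form q u v = (\<chi> i j. q (u $ j) (v $ i))"

definition orthonormal_eigenbasis ::
    "('v::real_vector \<Rightarrow> 'v \<Rightarrow> real) \<Rightarrow> ('v \<Rightarrow> 'v \<Rightarrow> real) \<Rightarrow> real \<Rightarrow> 'v^'m::finite \<Rightarrow> bool" where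
  "orthonormal_eigenbasis A B l u \<longleftrightarrow>
    span (range (($) u)) = eigenspace A B l \<and> matrix_form B u u = mat 1"

definition block_eigenpair ::
    "('v \<Rightarrow> 'v \<Rightarrow> real) \<Rightarrow> ('v \<Rightarrow> 'v \<Rightarrow> real) \<Rightarrow> 'v^'m::finite \<Rightarrow> real^'m^'m \<Rightarrow> bool" where
  "block_eigenpair A B u L \<longleftrightarrow>
    (\<forall>v. matrix_form A u v = matrix_form B u v ** L) \<and> matrix_form B u u = mat 1"

definition perturbed :: "'x::real_vector \<times> 'y::real_vector \<Rightarrow> ('w \<Rightarrow> 'x) \<Rightarrow> ('w \<Rightarrow> 'y)
    \<Rightarrow> real \<times> real \<Rightarrow> 'w \<Rightarrow> 'x \<times> 'y" where
  "perturbed p\<^sub>0 \<mu>\<^sub>1 \<epsilon>\<^sub>1 t \<omega> = (fst p\<^sub>0 + fst t *\<^sub>R \<mu>\<^sub>1 \<omega>, snd p\<^sub>0 + snd t *\<^sub>R \<epsilon>\<^sub>1 \<omega>)"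


section \<open>Consistency with the Bochner integral of the library\<close>

lemma simple_bochner_integral_bounded_strong:
  assumes f: "strongly_measurable M f"
    and s: "Bochner_Integration.simple_bochner_integrable M s"
    and t: "Bochner_Integration.simple_bochner_integrable M t"
  shows "ennreal (norm (Bochner_Integration.simple_bochner_integral M s
      - Bochner_Integration.simple_bochner_integral M t)) \<le>
    (\<integral>\<^sup>+ x. norm (f x - s x) \<partial>M) + (\<integral>\<^sup>+ x. norm (f x - t x) \<partial>M)"
proof -
  obtain r where r: "\<And>i::nat. simple_function M (r i)" "AE x in M. (\<lambda>i. r i x) \<longlonglongrightarrow> f x"
    using f unfolding strongly_measurable_def by blast
  have ss: "simple_function M s" "simple_function M t"
    using s t by (auto elim: simple_bochner_integrable.cases)
  have lim: "\<exists>g \<in> borel_measurable M. AE x in M. ennreal (norm (f x - w x)) = g x"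
    if w: "simple_function M w" for w
  proof (intro bexI)
    have m: "(\<lambda>x. ennreal (norm (r i x - w x))) \<in> borel_measurable M" for i
      by (intro borel_measurable_simple_function
          simple_function_compose1[where g = ennreal, OF simple_function_compose2[OF r(1) w]])
    show "(\<lambda>x. liminf (\<lambda>i. ennreal (norm (r i x - w x)))) \<in> borel_measurable M"
      using m by measurable
    show "AE x in M. ennreal (norm (f x - w x)) = liminf (\<lambda>i. ennreal (norm (r i x - w x)))"
      using r(2)
    proof eventually_elim
      case (elim x)
      have "(\<lambda>i. ennreal (norm (r i x - w x))) \<longlonglongrightarrow> ennreal (norm (f x - w x))"
        by (intro tendsto_intros elim)
      then show ?case
        by (rule lim_imp_Liminf[OF sequentially_bot, symmetric])
    qed
  qed
  obtain gs where gs: "gs \<in> borel_measurable M" "AE x in M. ennreal (norm (f x - s x)) = gs x"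
    using lim[OF ss(1)] by blast
  obtain gt where gt: "gt \<in> borel_measurable M" "AE x in M. ennreal (norm (f x - t x)) = gt x"
    using lim[OF ss(2)] by blast
  have "ennreal (norm (Bochner_Integration.simple_bochner_integral M s
      - Bochner_Integration.simple_bochner_integral M t))
      = norm (Bochner_Integration.simple_bochner_integral M (\<lambda>x. s x - t x))"
    using s t by (subst simple_bochner_integral_diff) auto
  also have "\<dots> \<le> Bochner_Integration.simple_bochner_integral M (\<lambda>x. norm (s x - t x))"
    using simple_bochner_integrable_compose2[of "(-)" M s t] s t
    by (auto intro!: simple_bochner_integral_norm_bound)
  also have "\<dots> = (\<integral>\<^sup>+x. norm (s x - t x) \<partial>M)"
    using simple_bochner_integrable_compose2[of "\<lambda>x y. norm (x - y)" M s t] s t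
    by (auto intro!: simple_bochner_integral_eq_nn_integral)
  also have "\<dots> \<le> (\<integral>\<^sup>+x. gs x + gt x \<partial>M)"
  proof (rule nn_integral_mono_AE)
    show "AE x in M. ennreal (norm (s x - t x)) \<le> gs x + gt x"
      using gs(2) gt(2)
    proof eventually_elim
      case (elim x)
      have "norm (s x - t x) \<le> norm (f x - s x) + norm (f x - t x)"
        by (metis dual_order.refl norm_diff_triangle_le norm_minus_commute)
      then show ?case
        unfolding elim[symmetric] by (metis ennreal_leI ennreal_plus norm_ge_zero)
    qed
  qed
  also have "\<dots> = (\<integral>\<^sup>+x. gs x \<partial>M) + (\<integral>\<^sup>+x. gt x \<partial>M)"
    by (rule nn_integral_add) (use gs gt in auto)
  also have "\<dots> = (\<integral>\<^sup>+ x. norm (f x - s x) \<partial>M) + (\<integral>\<^sup>+ x. norm (f x - t x) \<partial>M)"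
    using nn_integral_cong_AE[OF gs(2)] nn_integral_cong_AE[OF gt(2)] by simp
  finally show ?thesis .
qed

lemma has_bochner_mean_unique:
  assumes "has_bochner_mean M f x" "has_bochner_mean M f y"
  shows "x = y"
proof -
  obtain s where s: "\<And>i::nat. Bochner_Integration.simple_bochner_integrable M (s i)"
      "(\<lambda>i. \<integral>\<^sup>+\<omega>. ennreal (norm (f \<omega> - s i \<omega>)) \<partial>M) \<longlonglongrightarrow> 0"
      "(\<lambda>i. Bochner_Integration.simple_bochner_integral M (s i)) \<longlonglongrightarrow> x"
    using assms(1) unfolding has_bochner_mean_def by blast
  obtain t where t: "\<And>i::nat. Bochner_Integration.simple_bochner_integrable M (t i)"
      "(\<lambda>i. \<integral>\<^sup>+\<omega>. ennreal (norm (f \<omega> - t i \<omega>)) \<partial>M) \<longlonglongrightarrow> 0"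
      "(\<lambda>i. Bochner_Integration.simple_bochner_integral M (t i)) \<longlonglongrightarrow> y"
    using assms(2) unfolding has_bochner_mean_def by blast
  have f: "strongly_measurable M f"
    using assms(1) unfolding has_bochner_mean_def by blast
  have "(\<lambda>i. ennreal (norm (Bochner_Integration.simple_bochner_integral M (s i)
      - Bochner_Integration.simple_bochner_integral M (t i))))
      \<longlonglongrightarrow> ennreal (norm (x - y))"
    by (intro tendsto_intros s t)
  moreover have "(\<lambda>i. (\<integral>\<^sup>+\<omega>. ennreal (norm (f \<omega> - s i \<omega>)) \<partial>M)
      + (\<integral>\<^sup>+\<omega>. ennreal (norm (f \<omega> - t i \<omega>)) \<partial>M)) \<longlonglongrightarrow> 0 + 0"
    by (intro tendsto_add s t)
  ultimately have "ennreal (norm (x - y)) \<le> 0 + 0"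
    by (rule LIMSEQ_le) (use simple_bochner_integral_bounded_strong[OF f s(1) t(1)] in blast)
  then show ?thesis
    by simp
qed

lemma has_bochner_mean_if_has_bochner_integral:
  fixes f :: "'w \<Rightarrow> 'z::{banach,second_countable_topology}"
  assumes "has_bochner_integral M f x"
  shows "has_bochner_mean M f x"
proof -
  have "strongly_measurable M f"
  proof -
    have "f \<in> borel_measurable M"
      using assms by (rule borel_measurable_has_bochner_integral)
    from borel_measurable_implies_sequence_metric[OF this, of 0]
    show ?thesis
      unfolding strongly_measurable_def by (blast intro: AE_I2)
  qed
  with assms show ?thesis
    unfolding has_bochner_mean_def has_bochner_integral.simps by blast
qed

lemma bochner_mean_eq_lebesgue_integral:
  fixes f :: "'w \<Rightarrow> 'z::{banach,second_countable_topology}"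
  assumes "integrable M f"
  shows "bochner_mean M f = integral\<^sup>L M f"
  unfolding bochner_mean_def
  using has_bochner_mean_if_has_bochner_integral[OF has_bochner_integral_integrable[OF assms]]
  by (blast intro: has_bochner_mean_unique)

end

theory Submission
  imports Defs
begin

text \<open>
  The eigenvalue problem enters only through the analyticity of the trajectory. Around the
  reference parameter an analytic map satisfies \<open>g (p + h) = g p + D h + O(\<bar>h\<bar>\<^sup>2)\<close>, and a bounded
  perturbation \<open>h = (\<alpha> \<mu>\<^sub>1, \<beta> \<epsilon>\<^sub>1)\<close> makes this uniform in \<open>\<omega>\<close>. Since \<open>D h\<close> is centered, only the
  remainder contributes to the mean. In the covariance the product of the linear parts is of second
  order, all other products are of third order, and the mixed terms vanish in the mean: by
  uncorrelatedness they are orthogonal to every elementary tensor, and these span a dense subspace.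
\<close>

section \<open>Strong measurability\<close>

text \<open>The values lie in spaces that need not be separable, and random variables are fixed only
  up to null sets. The calculus of the mean therefore rests on approximation by simple functions and
  comes down to four facts: the mean is additive, it commutes with bounded linear maps, an almost
  sure norm bound passes to it, and on a probability space every almost surely bounded strongly
  measurable function into a Banach space has one. The covariance is handled by an exact identity
  instead of a chain of approximations. With linear part \<open>Y\<close> and remainder
  \<open>R\<close> of mean \<open>e\<close>, the expectation is the reference value plus
  \<open>e\<close>, because \<open>Y\<close> is already centered. The centered quantity is thus
  exactly \<open>Y + (R - e)\<close>, and only the products involving \<open>R - e\<close> create an
  error. The error has order three because \<open>Y\<close> has order one and \<open>R - e\<close>
  order two.\<close>

lemma strongly_measurable_const: "strongly_measurable M (\<lambda>_. c)"
  unfolding strongly_measurable_def by (intro exI[of _ "\<lambda>_ _. c"]) auto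

lemma strongly_measurable_Pair:
  assumes "strongly_measurable M f" "strongly_measurable M g"
  shows "strongly_measurable M (\<lambda>\<omega>. (f \<omega>, g \<omega>))"
proof -
  obtain s t where s: "\<And>i::nat. simple_function M (s i)" "AE \<omega> in M. (\<lambda>i. s i \<omega>) \<longlonglongrightarrow> f \<omega>"
    and t: "\<And>i::nat. simple_function M (t i)" "AE \<omega> in M. (\<lambda>i. t i \<omega>) \<longlonglongrightarrow> g \<omega>"
    using assms unfolding strongly_measurable_def by blast
  have "AE \<omega> in M. (\<lambda>i. (s i \<omega>, t i \<omega>)) \<longlonglongrightarrow> (f \<omega>, g \<omega>)"
    using s(2) t(2) by eventually_elim (intro tendsto_intros)
  moreover have "simple_function M (\<lambda>\<omega>. (s i \<omega>, t i \<omega>))" for i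
    by (intro simple_function_Pair s t)
  ultimately show ?thesis
    unfolding strongly_measurable_def by (intro exI[of _ "\<lambda>i \<omega>. (s i \<omega>, t i \<omega>)"]) auto
qed

text \<open>A simple function stays simple under composition with any map whatsoever, so continuity
  of \<open>F\<close> matters only at the almost sure values of \<open>f\<close>. The approximants
  may leave the region where \<open>F\<close> is well behaved, which is what happens later for a map
  that is analytic only on \<open>N\<close>.\<close>

lemma strongly_measurable_compose:
  assumes "strongly_measurable M f" and "AE \<omega> in M. isCont F (f \<omega>)"
  shows "strongly_measurable M (\<lambda>\<omega>. F (f \<omega>))"
proof -
  obtain s where s: "\<And>i::nat. simple_function M (s i)" "AE \<omega> in M. (\<lambda>i. s i \<omega>) \<longlonglongrightarrow> f \<omega>"
    using assms unfolding strongly_measurable_def by blast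
  have "AE \<omega> in M. (\<lambda>i. F (s i \<omega>)) \<longlonglongrightarrow> F (f \<omega>)"
    using s(2) assms(2) by eventually_elim (rule isCont_tendsto_compose)
  then show ?thesis
    unfolding strongly_measurable_def
    by (intro exI[of _ "\<lambda>i \<omega>. F (s i \<omega>)"]) (auto intro: simple_function_compose1 s)
qed

lemma strongly_measurable_compose2:
  assumes "strongly_measurable M f" "strongly_measurable M g"
    and "\<And>x y. isCont (\<lambda>p. F (fst p) (snd p)) (x, y)"
  shows "strongly_measurable M (\<lambda>\<omega>. F (f \<omega>) (g \<omega>))"
  using strongly_measurable_compose[OF strongly_measurable_Pair[OF assms(1,2)],
      of "\<lambda>p. F (fst p) (snd p)"] assms(3) by simp

lemma strongly_measurable_add:
  assumes "strongly_measurable M f" "strongly_measurable M g"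
  shows "strongly_measurable M (\<lambda>\<omega>. f \<omega> + g \<omega>)"
  by (intro strongly_measurable_compose2[OF assms, of "(+)"] continuous_intros)

lemma strongly_measurable_diff:
  assumes "strongly_measurable M f" "strongly_measurable M g"
  shows "strongly_measurable M (\<lambda>\<omega>. f \<omega> - g \<omega>)"
  by (intro strongly_measurable_compose2[OF assms, of "(-)"] continuous_intros)

lemma strongly_measurable_bounded_linear:
  assumes "strongly_measurable M f" "bounded_linear T"
  shows "strongly_measurable M (\<lambda>\<omega>. T (f \<omega>))"
  by (intro strongly_measurable_compose[OF assms(1)] AE_I2 bounded_linear.isCont[OF assms(2)])
    auto

lemma strongly_measurable_bounded_bilinear:
  assumes "strongly_measurable M f" "strongly_measurable M g" "bounded_bilinear T"
  shows "strongly_measurable M (\<lambda>\<omega>. T (f \<omega>) (g \<omega>))"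
  by (intro strongly_measurable_compose2[OF assms(1,2), of T] bounded_bilinear.isCont[OF assms(3)]
      continuous_intros)

lemma strongly_measurable_simple:
  "simple_function M s \<Longrightarrow> strongly_measurable M s"
  unfolding strongly_measurable_def by (intro exI[of _ "\<lambda>_. s"]) auto

text \<open>The approximants converge only almost everywhere. Their liminf exists everywhere and is
  measurable, so it serves as a measurable representative of the norm.\<close>

lemma strongly_measurable_norm:
  assumes "strongly_measurable M f"
  obtains g where "g \<in> borel_measurable M" "AE \<omega> in M. ennreal (norm (f \<omega>)) = g \<omega>"
proof -
  obtain s where s: "\<And>i::nat. simple_function M (s i)" "AE \<omega> in M. (\<lambda>i. s i \<omega>) \<longlonglongrightarrow> f \<omega>"
    using assms unfolding strongly_measurable_def by blast
  show thesis
  proof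
    have "(\<lambda>\<omega>. ennreal (norm (s i \<omega>))) \<in> borel_measurable M" for i
      by (intro borel_measurable_simple_function simple_function_compose1[OF s(1)])
    then show "(\<lambda>\<omega>. liminf (\<lambda>i. ennreal (norm (s i \<omega>)))) \<in> borel_measurable M"
      by measurable
    show "AE \<omega> in M. ennreal (norm (f \<omega>)) = liminf (\<lambda>i. ennreal (norm (s i \<omega>)))"
      using s(2)
    proof eventually_elim
      case (elim \<omega>)
      have "(\<lambda>i. ennreal (norm (s i \<omega>))) \<longlonglongrightarrow> ennreal (norm (f \<omega>))"
        by (intro tendsto_intros elim)
      then show ?case
        by (rule lim_imp_Liminf[OF sequentially_bot, symmetric])
    qed
  qed
qed

text \<open>The nonnegative integral is a supremum over simple functions below the integrand, and
  for nonmeasurable integrands such a supremum need not be subadditive. The estimate therefore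
  passes through measurable representatives of the norms.\<close>

lemma nn_integral_norm_add_le:
  assumes "strongly_measurable M f" "strongly_measurable M g"
  shows "(\<integral>\<^sup>+\<omega>. ennreal (norm (f \<omega> + g \<omega>)) \<partial>M)
    \<le> (\<integral>\<^sup>+\<omega>. ennreal (norm (f \<omega>)) \<partial>M) + (\<integral>\<^sup>+\<omega>. ennreal (norm (g \<omega>)) \<partial>M)"
proof -
  obtain f' where f': "f' \<in> borel_measurable M" "AE \<omega> in M. ennreal (norm (f \<omega>)) = f' \<omega>"
    using strongly_measurable_norm[OF assms(1)] .
  obtain g' where g': "g' \<in> borel_measurable M" "AE \<omega> in M. ennreal (norm (g \<omega>)) = g' \<omega>"
    using strongly_measurable_norm[OF assms(2)] .
  have "(\<integral>\<^sup>+\<omega>. ennreal (norm (f \<omega> + g \<omega>)) \<partial>M) \<le> (\<integral>\<^sup>+\<omega>. f' \<omega> + g' \<omega> \<partial>M)"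
  proof (rule nn_integral_mono_AE)
    show "AE \<omega> in M. ennreal (norm (f \<omega> + g \<omega>)) \<le> f' \<omega> + g' \<omega>"
      using f'(2) g'(2)
      by eventually_elim
        (metis ennreal_leI ennreal_plus norm_ge_zero norm_triangle_ineq)
  qed
  also have "\<dots> = (\<integral>\<^sup>+\<omega>. f' \<omega> \<partial>M) + (\<integral>\<^sup>+\<omega>. g' \<omega> \<partial>M)"
    by (rule nn_integral_add[OF f'(1) g'(1)])
  also have "\<dots> = (\<integral>\<^sup>+\<omega>. ennreal (norm (f \<omega>)) \<partial>M) + (\<integral>\<^sup>+\<omega>. ennreal (norm (g \<omega>)) \<partial>M)"
    using nn_integral_cong_AE[OF f'(2)] nn_integral_cong_AE[OF g'(2)] by simp
  finally show ?thesis .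
qed


section \<open>The Bochner mean\<close>

lemma bochner_mean_eqI: "has_bochner_mean M f x \<Longrightarrow> bochner_mean M f = x"
  unfolding bochner_mean_def by (blast intro: has_bochner_mean_unique)

text \<open>Lets a mean be assembled by composing rules first, with integrand and value matched to
  the wanted form afterwards.\<close>

lemma has_bochner_mean_cong:
  "has_bochner_mean M f x \<Longrightarrow> (\<And>\<omega>. f \<omega> = g \<omega>) \<Longrightarrow> x = y \<Longrightarrow> has_bochner_mean M g y"
  by (metis ext)

lemma has_bochner_mean_add:
  assumes f: "has_bochner_mean M f x" and g: "has_bochner_mean M g y"
  shows "has_bochner_mean M (\<lambda>\<omega>. f \<omega> + g \<omega>) (x + y)"
proof -
  have sm: "strongly_measurable M f" "strongly_measurable M g"
    using f g unfolding has_bochner_mean_def by auto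
  obtain s where s: "\<And>i::nat. Bochner_Integration.simple_bochner_integrable M (s i)"
      "(\<lambda>i. \<integral>\<^sup>+\<omega>. ennreal (norm (f \<omega> - s i \<omega>)) \<partial>M) \<longlonglongrightarrow> 0"
      "(\<lambda>i. Bochner_Integration.simple_bochner_integral M (s i)) \<longlonglongrightarrow> x"
    using f unfolding has_bochner_mean_def by blast
  obtain t where t: "\<And>i::nat. Bochner_Integration.simple_bochner_integrable M (t i)"
      "(\<lambda>i. \<integral>\<^sup>+\<omega>. ennreal (norm (g \<omega> - t i \<omega>)) \<partial>M) \<longlonglongrightarrow> 0"
      "(\<lambda>i. Bochner_Integration.simple_bochner_integral M (t i)) \<longlonglongrightarrow> y"
    using g unfolding has_bochner_mean_def by blast
  have simple: "simple_function M (s i)" "simple_function M (t i)" for i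
    using s(1)[of i] t(1)[of i] by (auto elim: simple_bochner_integrable.cases)
  have "(\<lambda>i. \<integral>\<^sup>+\<omega>. ennreal (norm (f \<omega> + g \<omega> - (s i \<omega> + t i \<omega>))) \<partial>M) \<longlonglongrightarrow> 0"
  proof (rule tendsto_sandwich[OF _ _ tendsto_const])
    show "(\<lambda>i. (\<integral>\<^sup>+\<omega>. ennreal (norm (f \<omega> - s i \<omega>)) \<partial>M)
        + (\<integral>\<^sup>+\<omega>. ennreal (norm (g \<omega> - t i \<omega>)) \<partial>M)) \<longlonglongrightarrow> 0"
      using tendsto_add[OF s(2) t(2)] by simp
    show "\<forall>\<^sub>F i in sequentially. (\<integral>\<^sup>+\<omega>. ennreal (norm (f \<omega> + g \<omega> - (s i \<omega> + t i \<omega>))) \<partial>M)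
      \<le> (\<integral>\<^sup>+\<omega>. ennreal (norm (f \<omega> - s i \<omega>)) \<partial>M)
        + (\<integral>\<^sup>+\<omega>. ennreal (norm (g \<omega> - t i \<omega>)) \<partial>M)"
      using nn_integral_norm_add_le[of M "\<lambda>\<omega>. f \<omega> - s i \<omega>" "\<lambda>\<omega>. g \<omega> - t i \<omega>" for i]
      by (intro always_eventually allI)
        (simp add: strongly_measurable_diff sm strongly_measurable_simple simple add_diff_add)
  qed auto
  moreover have "(\<lambda>i. Bochner_Integration.simple_bochner_integral M (\<lambda>\<omega>. s i \<omega> + t i \<omega>))
      \<longlonglongrightarrow> x + y"
    using tendsto_add[OF s(3) t(3)] by (simp add: simple_bochner_integral_add s(1) t(1))
  moreover have "Bochner_Integration.simple_bochner_integrable M (\<lambda>\<omega>. s i \<omega> + t i \<omega>)" for i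
    using simple_bochner_integrable_compose2[of "(+)" M "s i" "t i"] s(1) t(1) by simp
  ultimately show ?thesis
    unfolding has_bochner_mean_def
    by (intro conjI exI[of _ "\<lambda>i \<omega>. s i \<omega> + t i \<omega>"] strongly_measurable_add sm allI)
qed

lemma has_bochner_mean_bounded_linear:
  assumes T: "bounded_linear T" and f: "has_bochner_mean M f x"
  shows "has_bochner_mean M (\<lambda>\<omega>. T (f \<omega>)) (T x)"
proof -
  interpret T: bounded_linear T by fact
  obtain K where K: "\<And>x. norm (T x) \<le> norm x * K" "0 \<le> K"
    using T.nonneg_bounded by blast
  have sm: "strongly_measurable M f"
    using f unfolding has_bochner_mean_def by auto
  obtain s where s: "\<And>i::nat. Bochner_Integration.simple_bochner_integrable M (s i)"
      "(\<lambda>i. \<integral>\<^sup>+\<omega>. ennreal (norm (f \<omega> - s i \<omega>)) \<partial>M) \<longlonglongrightarrow> 0"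
      "(\<lambda>i. Bochner_Integration.simple_bochner_integral M (s i)) \<longlonglongrightarrow> x"
    using f unfolding has_bochner_mean_def by blast
  have simple: "simple_function M (s i)" for i
    using s(1)[of i] by (auto elim: simple_bochner_integrable.cases)
  have "(\<lambda>i. \<integral>\<^sup>+\<omega>. ennreal (norm (T (f \<omega>) - T (s i \<omega>))) \<partial>M) \<longlonglongrightarrow> 0"
  proof (rule tendsto_sandwich[OF _ _ tendsto_const])
    show "(\<lambda>i. ennreal K * (\<integral>\<^sup>+\<omega>. ennreal (norm (f \<omega> - s i \<omega>)) \<partial>M)) \<longlonglongrightarrow> 0"
      using ennreal_tendsto_cmult[OF _ s(2), of "ennreal K"] by simp
    have "(\<integral>\<^sup>+\<omega>. ennreal (norm (T (f \<omega>) - T (s i \<omega>))) \<partial>M)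
        \<le> ennreal K * (\<integral>\<^sup>+\<omega>. ennreal (norm (f \<omega> - s i \<omega>)) \<partial>M)" for i
    proof -
      obtain h where h: "h \<in> borel_measurable M"
          "AE \<omega> in M. ennreal (norm (f \<omega> - s i \<omega>)) = h \<omega>"
        using strongly_measurable_norm[OF strongly_measurable_diff[OF sm
            strongly_measurable_simple[OF simple]]] by blast
      have "(\<integral>\<^sup>+\<omega>. ennreal (norm (T (f \<omega>) - T (s i \<omega>))) \<partial>M) \<le> (\<integral>\<^sup>+\<omega>. ennreal K * h \<omega> \<partial>M)"
      proof (rule nn_integral_mono_AE)
        show "AE \<omega> in M. ennreal (norm (T (f \<omega>) - T (s i \<omega>))) \<le> ennreal K * h \<omega>"
          using h(2)
        proof eventually_elim
          case (elim \<omega>)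
          have "ennreal (norm (T (f \<omega>) - T (s i \<omega>))) \<le> ennreal (K * norm (f \<omega> - s i \<omega>))"
            using K(1)[of "f \<omega> - s i \<omega>"] by (intro ennreal_leI) (simp add: T.diff mult.commute)
          then show ?case
            by (simp add: ennreal_mult K(2) elim[symmetric])
        qed
      qed
      then show ?thesis
        using h by (simp add: nn_integral_cmult nn_integral_cong_AE)
    qed
    then show "\<forall>\<^sub>F i in sequentially. (\<integral>\<^sup>+\<omega>. ennreal (norm (T (f \<omega>) - T (s i \<omega>))) \<partial>M)
        \<le> ennreal K * (\<integral>\<^sup>+\<omega>. ennreal (norm (f \<omega> - s i \<omega>)) \<partial>M)"
      by simp
  qed auto
  moreover have "(\<lambda>i. Bochner_Integration.simple_bochner_integral M (\<lambda>\<omega>. T (s i \<omega>))) \<longlonglongrightarrow> T x"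
    using T.tendsto[OF s(3)]
    by (simp add: simple_bochner_integral_linear[OF T.linear_axioms s(1)])
  \<comment> \<open>The binary composition rule is fed the same function twice. It requires 0 to be
    mapped to 0, so that the support keeps finite measure.\<close>
  moreover have "Bochner_Integration.simple_bochner_integrable M (\<lambda>\<omega>. T (s i \<omega>))" for i
    using simple_bochner_integrable_compose2[of "\<lambda>x y. T x" M "s i" "s i"] s(1) T.zero by simp
  ultimately show ?thesis
    unfolding has_bochner_mean_def
    by (intro conjI exI[of _ "\<lambda>i \<omega>. T (s i \<omega>)"] strongly_measurable_bounded_linear[OF sm T] allI)
qed

lemma (in prob_space) has_bochner_mean_const: "has_bochner_mean M (\<lambda>_. c) c"
proof -
  have "Bochner_Integration.simple_bochner_integrable M (\<lambda>_. c)"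
    by (intro simple_bochner_integrable.intros) (auto simp: emeasure_space_1)
  moreover have "Bochner_Integration.simple_bochner_integral M (\<lambda>_. c) = c"
  proof -
    have "(\<lambda>_. c) ` space M = {c}"
      using not_empty by auto
    then show ?thesis
      using not_empty prob_space unfolding simple_bochner_integral_def by simp
  qed
  ultimately show ?thesis
    unfolding has_bochner_mean_def
    by (intro conjI exI[of _ "\<lambda>_ _. c"] strongly_measurable_const) auto
qed

text \<open>A space of mass one is not a null set, so the bound is attained at some point. This
  supplies the sign of the bounding constants, which is needed to carry them through
  \<open>ennreal\<close> and through products of estimates.\<close>

lemma (in prob_space) AE_norm_le_nonneg:
  assumes "AE \<omega> in M. norm (f \<omega>) \<le> C"
  shows "0 \<le> C"
proof (rule ccontr)
  assume neg: "\<not> 0 \<le> C"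
  have "AE \<omega> in M. False"
    using assms by eventually_elim (use neg norm_ge_zero order_trans in blast)
  then show False
    by simp
qed

lemma (in prob_space) has_bochner_mean_norm_le:
  fixes f :: "'a \<Rightarrow> 'z::real_normed_vector"
  assumes f: "has_bochner_mean M f x" and C: "AE \<omega> in M. norm (f \<omega>) \<le> C"
  shows "norm x \<le> C"
proof -
  have C0: "0 \<le> C"
    using C by (rule AE_norm_le_nonneg)
  have sm: "strongly_measurable M f"
    using f unfolding has_bochner_mean_def by auto
  obtain s where s: "\<And>i::nat. Bochner_Integration.simple_bochner_integrable M (s i)"
      "(\<lambda>i. \<integral>\<^sup>+\<omega>. ennreal (norm (f \<omega> - s i \<omega>)) \<partial>M) \<longlonglongrightarrow> 0"
      "(\<lambda>i. Bochner_Integration.simple_bochner_integral M (s i)) \<longlonglongrightarrow> x"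
    using f unfolding has_bochner_mean_def by blast
  \<comment> \<open>Comparing \<open>s i\<close> with the simple function 0 turns the stability
    estimate for two approximants into a bound by the integral of the norm of
    \<open>f\<close>.\<close>
  have z: "Bochner_Integration.simple_bochner_integrable M (\<lambda>_. 0 :: 'z)"
    by (intro simple_bochner_integrable.intros) auto
  have "Bochner_Integration.simple_bochner_integral M (\<lambda>_. 0 :: 'z) = 0"
    unfolding simple_bochner_integral_def by (rule sum.neutral) auto
  then have le: "ennreal (norm (Bochner_Integration.simple_bochner_integral M (s i)))
      \<le> (\<integral>\<^sup>+ \<omega>. norm (f \<omega> - s i \<omega>) \<partial>M) + (\<integral>\<^sup>+ \<omega>. norm (f \<omega>) \<partial>M)" for i
    using simple_bochner_integral_bounded_strong[OF sm s(1)[of i] z] by simp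
  have "ennreal (norm x) \<le> 0 + (\<integral>\<^sup>+ \<omega>. norm (f \<omega>) \<partial>M)"
  proof (rule LIMSEQ_le)
    show "(\<lambda>i. ennreal (norm (Bochner_Integration.simple_bochner_integral M (s i))))
        \<longlonglongrightarrow> ennreal (norm x)"
      by (intro tendsto_intros s)
    show "(\<lambda>i. (\<integral>\<^sup>+ \<omega>. norm (f \<omega> - s i \<omega>) \<partial>M) + (\<integral>\<^sup>+ \<omega>. norm (f \<omega>) \<partial>M))
        \<longlonglongrightarrow> 0 + (\<integral>\<^sup>+ \<omega>. norm (f \<omega>) \<partial>M)"
      by (intro tendsto_add s tendsto_const)
  qed (use le in blast)
  also have "\<dots> \<le> (\<integral>\<^sup>+ \<omega>. ennreal C \<partial>M)"
    unfolding add_0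
  proof (rule nn_integral_mono_AE)
    show "AE \<omega> in M. ennreal (norm (f \<omega>)) \<le> ennreal C"
      using C by eventually_elim (rule ennreal_leI)
  qed
  also have "\<dots> = ennreal C"
    by (simp add: emeasure_space_1)
  finally show ?thesis
    using C0 by simp
qed

text \<open>Truncation makes the approximants uniformly bounded, dominated convergence then gives
  approximation in mean, and completeness provides the limit of the integrals. This is the source of
  all means of remainders and of tensor products below.\<close>

lemma (in prob_space) has_bochner_mean_bounded:
  fixes f :: "'a \<Rightarrow> 'z::banach"
  assumes sm: "strongly_measurable M f" and C: "AE \<omega> in M. norm (f \<omega>) \<le> C"
  shows "has_bochner_mean M f (bochner_mean M f)"
proof -
  have C0: "0 \<le> C"
    using C by (rule AE_norm_le_nonneg)
  obtain r where r: "\<And>i::nat. simple_function M (r i)" "AE \<omega> in M. (\<lambda>i. r i \<omega>) \<longlonglongrightarrow> f \<omega>"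
    using sm unfolding strongly_measurable_def by blast
  \<comment> \<open>The margin 1 above \<open>C\<close> makes the truncation eventually inactive:
    almost surely the limit has norm at most \<open>C\<close>, strictly below the threshold.\<close>
  define tr where "tr z = (if norm z \<le> C + 1 then z else 0)" for z :: 'z
  define s where "s i \<omega> = tr (r i \<omega>)" for i \<omega>
  have s: "simple_function M (s i)" for i
    unfolding s_def by (rule simple_function_compose1[OF r(1)])
  have s_le: "norm (s i \<omega>) \<le> C + 1" for i \<omega>
    unfolding s_def tr_def using C0 by auto
  have s_lim: "AE \<omega> in M. (\<lambda>i. s i \<omega>) \<longlonglongrightarrow> f \<omega>"
    using r(2) C
  proof eventually_elim
    case (elim \<omega>)
    have "\<forall>\<^sub>F i in sequentially. norm (r i \<omega>) < C + 1"
      using elim by (intro order_tendstoD(2)[OF tendsto_norm]) auto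
    then have "\<forall>\<^sub>F i in sequentially. r i \<omega> = s i \<omega>"
      by eventually_elim (auto simp: s_def tr_def)
    then show ?case
      by (rule Lim_transform_eventually[OF elim(1)])
  qed
  have sbi: "Bochner_Integration.simple_bochner_integrable M (s i)" for i
    using s emeasure_finite by (intro simple_bochner_integrable.intros) auto
  have "\<exists>g. g \<in> borel_measurable M \<and> (AE \<omega> in M. ennreal (norm (f \<omega> - s i \<omega>)) = g \<omega>)" for i
    using strongly_measurable_norm[OF strongly_measurable_diff[OF sm
        strongly_measurable_simple[OF s]]] by blast
  then obtain g where g: "\<And>i. g i \<in> borel_measurable M"
      "\<And>i. AE \<omega> in M. ennreal (norm (f \<omega> - s i \<omega>)) = g i \<omega>"
    by metis
  have all_g: "AE \<omega> in M. \<forall>i. ennreal (norm (f \<omega> - s i \<omega>)) = g i \<omega>"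
    using g(2) by (simp add: AE_all_countable)
  have "(\<lambda>i. \<integral>\<^sup>+\<omega>. g i \<omega> \<partial>M) \<longlonglongrightarrow> (\<integral>\<^sup>+\<omega>. 0 \<partial>M)"
  proof (rule nn_integral_dominated_convergence[where w = "\<lambda>_. ennreal (2 * C + 1)"])
    \<comment> \<open>The dominating constant is \<open>C\<close> for \<open>f\<close> plus
      \<open>C + 1\<close> for the truncated approximant.\<close>
    show "AE \<omega> in M. g i \<omega> \<le> ennreal (2 * C + 1)" for i
      using g(2)[of i] C
    proof eventually_elim
      case (elim \<omega>)
      have "norm (f \<omega> - s i \<omega>) \<le> 2 * C + 1"
        using elim(2) s_le[of i \<omega>] norm_triangle_ineq4[of "f \<omega>" "s i \<omega>"] by linarith
      then show ?case
        unfolding elim(1)[symmetric] by (rule ennreal_leI)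
    qed
    show "AE \<omega> in M. (\<lambda>i. g i \<omega>) \<longlonglongrightarrow> 0"
      using all_g s_lim
    proof eventually_elim
      case (elim \<omega>)
      have "(\<lambda>i. ennreal (norm (f \<omega> - s i \<omega>))) \<longlonglongrightarrow> ennreal (norm (f \<omega> - f \<omega>))"
        by (intro tendsto_intros elim)
      then show ?case
        using elim(1) by simp
    qed
  qed (auto simp: g emeasure_space_1 less_top[symmetric])
  then have lim0: "(\<lambda>i. \<integral>\<^sup>+\<omega>. ennreal (norm (f \<omega> - s i \<omega>)) \<partial>M) \<longlonglongrightarrow> 0"
    using nn_integral_cong_AE[OF g(2)] by simp
  \<comment> \<open>Two integrals differ by at most the sum of the two approximation errors, each
    eventually below \<open>e / 2\<close>.\<close>
  have "Cauchy (\<lambda>i. Bochner_Integration.simple_bochner_integral M (s i))"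
  proof (rule metric_CauchyI)
    fix e :: real
    assume "0 < e"
    then have "\<forall>\<^sub>F i in sequentially. (\<integral>\<^sup>+\<omega>. ennreal (norm (f \<omega> - s i \<omega>)) \<partial>M) < ennreal (e / 2)"
      by (intro order_tendstoD(2)[OF lim0]) simp
    then obtain k where k: "\<And>i. i \<ge> k \<Longrightarrow>
        (\<integral>\<^sup>+\<omega>. ennreal (norm (f \<omega> - s i \<omega>)) \<partial>M) < ennreal (e / 2)"
      unfolding eventually_sequentially by blast
    have "dist (Bochner_Integration.simple_bochner_integral M (s i))
        (Bochner_Integration.simple_bochner_integral M (s j)) < e" if "i \<ge> k" "j \<ge> k" for i j
    proof -
      have "ennreal (dist (Bochner_Integration.simple_bochner_integral M (s i))
          (Bochner_Integration.simple_bochner_integral M (s j)))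
          \<le> (\<integral>\<^sup>+ x. norm (f x - s i x) \<partial>M) + (\<integral>\<^sup>+ x. norm (f x - s j x) \<partial>M)"
        unfolding dist_norm by (rule simple_bochner_integral_bounded_strong[OF sm sbi sbi])
      also have "\<dots> < ennreal (e / 2) + ennreal (e / 2)"
        using k that by (intro add_strict_mono) auto
      also have "\<dots> = ennreal e"
        using \<open>0 < e\<close> by (subst ennreal_plus[symmetric]) auto
      finally show ?thesis
        by (simp add: ennreal_less_iff)
    qed
    then show "\<exists>k. \<forall>i\<ge>k. \<forall>j\<ge>k. dist (Bochner_Integration.simple_bochner_integral M (s i))
        (Bochner_Integration.simple_bochner_integral M (s j)) < e"
      by blast
  qed
  then obtain x where "(\<lambda>i. Bochner_Integration.simple_bochner_integral M (s i)) \<longlonglongrightarrow> x"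
    using Cauchy_convergent convergent_def by blast
  then have "has_bochner_mean M f x"
    unfolding has_bochner_mean_def using sm sbi lim0 by blast
  then show ?thesis
    by (simp add: bochner_mean_eqI)
qed


section \<open>Hilbert tensor products\<close>

lemma hilbert_tensor_product_norm:
  assumes "hilbert_tensor_product ten"
  shows "norm (ten x y) = norm x * norm y"
proof -
  have "inner (ten x y) (ten x y) = inner x x * inner y y"
    using assms unfolding hilbert_tensor_product_def by blast
  then show ?thesis
    by (simp add: norm_eq_sqrt_inner real_sqrt_mult)
qed

lemma hilbert_tensor_product_bounded_bilinear:
  assumes "hilbert_tensor_product ten"
  shows "bounded_bilinear ten"
proof -
  have bil: "bilinear ten"
    using assms unfolding hilbert_tensor_product_def by blast
  show ?thesis
    by (rule bounded_bilinear.intro)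
      (auto simp: bilinear_ladd[OF bil] bilinear_radd[OF bil] bilinear_lmul[OF bil]
        bilinear_rmul[OF bil] hilbert_tensor_product_norm[OF assms] intro!: exI[of _ 1])
qed

text \<open>The vectors orthogonal to \<open>e\<close> form a closed subspace. Since it contains the
  elementary tensors it is the whole space, so \<open>e\<close> is orthogonal to itself.\<close>

lemma hilbert_tensor_product_eq_0:
  assumes ten: "hilbert_tensor_product ten" and orth: "\<And>x y. inner e (ten x y) = 0"
  shows "e = 0"
proof -
  have "e \<in> closure (span (range (\<lambda>(x, y). ten x y)))"
    using ten unfolding hilbert_tensor_product_def by auto
  moreover have "closure (span (range (\<lambda>(x, y). ten x y))) \<subseteq> {v. inner e v = 0}"
  proof (rule closure_minimal)
    show "span (range (\<lambda>(x, y). ten x y)) \<subseteq> {v. inner e v = 0}"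
      by (rule span_minimal) (auto simp: orth subspace_hyperplane)
    show "closed {v. inner e v = 0}"
      by (rule closed_hyperplane)
  qed
  ultimately have "inner e e = 0"
    by blast
  then show ?thesis
    by simp
qed


section \<open>Taylor expansion of analytic maps\<close>

text \<open>\<open>D\<close> is the coefficient on singleton lists. Every later term carries at
  least two factors \<open>norm h\<close>. Two of them are kept, the others are bounded by
  \<open>r\<close>, and the remaining series converges by the summability at radius
  \<open>r\<close>.\<close>

lemma real_analytic_at_taylor1:
  fixes f :: "'p::real_normed_vector \<Rightarrow> 'q::banach"
  assumes "real_analytic_at f p"
  obtains D K r where "bounded_linear D" "0 < r" "0 \<le> K"
    "\<And>h. norm h < r \<Longrightarrow> norm (f (p + h) - f p - D h) \<le> K * (norm h)\<^sup>2"
proof -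
  obtain A C r where r: "0 < r"
    and lin: "\<And>hs i. i < length hs \<Longrightarrow> linear (\<lambda>h. A (hs[i := h]))"
    and C: "\<And>k. 0 \<le> C k" and le: "\<And>hs. norm (A hs) \<le> C (length hs) * prod_list (map norm hs)"
    and summ: "summable (\<lambda>k. C k * r ^ k)"
    and sums: "\<And>h. norm h < r \<Longrightarrow> (\<lambda>k. A (replicate k h)) sums f (p + h)"
    using assms unfolding real_analytic_at_def by blast
  have le_pow: "norm (A (replicate k h)) \<le> C k * norm h ^ k" for k h
    using le[of "replicate k h"] by simp
  \<comment> \<open>At increment 0 the norm bound contains the factor \<open>0 ^ k\<close>, which
    kills every term except that of the empty list.\<close>
  have f0: "f p = A []"
  proof -
    have "(\<lambda>k. A (replicate k 0)) sums f (p + 0)"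
      using r by (intro sums) simp
    moreover have "A (replicate k 0) = 0" if "k \<noteq> 0" for k
      using le_pow[of k 0] that by (simp add: power_0_left)
    then have "(\<lambda>k. A (replicate k 0)) sums (\<Sum>k\<in>{0}. A (replicate k 0))"
      by (intro sums_finite) auto
    ultimately show ?thesis
      using sums_unique2 by fastforce
  qed
  \<comment> \<open>Obtained from \<open>norm h ^ (k + 2) \<le> r ^ k * (norm h)\<^sup>2\<close>;
    dividing by \<open>r\<^sup>2\<close> restores the missing powers of \<open>r\<close>.\<close>
  define K where "K = (\<Sum>k. C (k + 2) * r ^ (k + 2)) / r\<^sup>2"
  have summ2: "summable (\<lambda>k. C (k + 2) * r ^ (k + 2))"
    using summ by (subst summable_iff_shift)
  show thesis
  proof
    show "bounded_linear (\<lambda>h. A [h])"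
    proof (rule bounded_linear_intro)
      have l: "linear (\<lambda>h. A [h])"
        using lin[of 0 "[0]"] by simp
      show "A [x + y] = A [x] + A [y]" "A [c *\<^sub>R x] = c *\<^sub>R A [x]" for x y c
        using linear_add[OF l] linear_scale[OF l] by auto
      show "norm (A [x]) \<le> norm x * C 1" for x
        using le[of "[x]"] by (simp add: mult.commute)
    qed
    show "0 \<le> K"
      unfolding K_def using C r by (intro divide_nonneg_nonneg suminf_nonneg summ2) auto
    show "norm (f (p + h) - f p - A [h]) \<le> K * (norm h)\<^sup>2" if h: "norm h < r" for h
    proof -
      have "(\<lambda>k. A (replicate (k + 2) h)) sums (f (p + h) - (\<Sum>k<2. A (replicate k h)))"
        by (rule sums_split_initial_segment[OF sums[OF h]])
      then have eq: "f (p + h) - f p - A [h] = (\<Sum>k. A (replicate (k + 2) h))"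
        by (simp add: sums_iff f0 numeral_2_eq_2 algebra_simps)
      have bnd: "norm (A (replicate (k + 2) h))
          \<le> (norm h)\<^sup>2 / r\<^sup>2 * (C (k + 2) * r ^ (k + 2))" for k
      proof -
        have "norm (A (replicate (k + 2) h)) \<le> C (k + 2) * norm h ^ (k + 2)"
          by (rule le_pow)
        also have "\<dots> \<le> C (k + 2) * (r ^ k * (norm h)\<^sup>2)"
          unfolding power_add using h C by (intro mult_left_mono mult_right_mono power_mono) auto
        also have "\<dots> = (norm h)\<^sup>2 / r\<^sup>2 * (C (k + 2) * r ^ (k + 2))"
          using r by (simp add: power_add power2_eq_square field_simps)
        finally show ?thesis .
      qed
      have "norm (f (p + h) - f p - A [h])
          \<le> (\<Sum>k. (norm h)\<^sup>2 / r\<^sup>2 * (C (k + 2) * r ^ (k + 2)))"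
        unfolding eq by (intro norm_suminf_le bnd summable_mult summ2)
      also have "\<dots> = K * (norm h)\<^sup>2"
        unfolding K_def by (subst suminf_mult[OF summ2]) simp
      finally show ?thesis .
    qed
  qed (fact r)
qed

lemma has_derivative_if_quadratic_remainder:
  assumes D: "bounded_linear D" and r: "0 < r"
    and R: "\<And>h. norm h < r \<Longrightarrow> norm (f (p + h) - f p - D h) \<le> K * (norm h)\<^sup>2"
  shows "(f has_derivative D) (at p)"
  unfolding has_derivative_at
proof (intro conjI D)
  show "(\<lambda>h. norm (f (p + h) - f p - D h) / norm h) \<midarrow>0\<rightarrow> 0"
  proof (rule tendsto_sandwich[OF _ _ tendsto_const])
    show "(\<lambda>h. K * norm h) \<midarrow>0\<rightarrow> 0"
      by (rule tendsto_eq_intros refl)+ simp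
    show "\<forall>\<^sub>F h in at 0. norm (f (p + h) - f p - D h) / norm h \<le> K * norm h"
      unfolding eventually_at using r R
      by (intro exI[of _ r]) (auto simp: power2_eq_square divide_le_eq mult.assoc)
  qed auto
qed

lemma real_analytic_at_isCont:
  fixes f :: "'p::real_normed_vector \<Rightarrow> 'q::banach"
  assumes "real_analytic_at f p"
  shows "isCont f p"
  using real_analytic_at_taylor1[OF assms] has_derivative_if_quadratic_remainder
    has_derivative_continuous by metis


text \<open>Applying \<open>T\<close> to each coefficient multiplies its bound by a constant and
  keeps the radius. With \<open>T\<close> a projection this separates the eigenbasis from the
  eigenvalue matrix in the jointly analytic trajectory.\<close>

lemma real_analytic_at_bounded_linear:
  assumes T: "bounded_linear T" and f: "real_analytic_at f p"
  shows "real_analytic_at (\<lambda>p. T (f p)) p"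
proof -
  interpret T: bounded_linear T by fact
  obtain K where K: "\<And>x. norm (T x) \<le> norm x * K" "0 \<le> K"
    using T.nonneg_bounded by blast
  obtain A C r where r: "0 < r"
    and lin: "\<And>hs i. i < length hs \<Longrightarrow> linear (\<lambda>h. A (hs[i := h]))"
    and C: "\<And>k. 0 \<le> C k" and le: "\<And>hs. norm (A hs) \<le> C (length hs) * prod_list (map norm hs)"
    and summ: "summable (\<lambda>k. C k * r ^ k)"
    and sums: "\<And>h. norm h < r \<Longrightarrow> (\<lambda>k. A (replicate k h)) sums f (p + h)"
    using f unfolding real_analytic_at_def by blast
  have "linear (\<lambda>h. T (A (hs[i := h])))" if "i < length hs" for hs i
    using linear_compose[OF lin[OF that] T.linear_axioms] by (simp add: o_def)
  moreover have "norm (T (A hs)) \<le> (K * C (length hs)) * prod_list (map norm hs)" for hs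
    using order_trans[OF K(1) mult_right_mono[OF le K(2)]] by (simp add: mult_ac)
  moreover have "summable (\<lambda>k. K * C k * r ^ k)"
    using summable_mult[OF summ, of K] by (simp add: mult.assoc)
  ultimately show ?thesis
    unfolding real_analytic_at_def using r C K(2) T.sums[OF sums]
    by (intro exI[of _ "\<lambda>hs. T (A hs)"] exI[of _ "\<lambda>k. K * C k"] exI[of _ r]) auto
qed


section \<open>Moments of a randomly perturbed analytic map\<close>

text \<open>Needed because the tensor product is not commutative: both mixed terms, in either order,
  occur in the covariance.\<close>

lemma uncorrelated_sym:
  assumes "uncorrelated M f g"
  shows "uncorrelated M g f"
  using assms unfolding uncorrelated_def by (subst mult.commute) blast

text \<open>Boundedness gives a mean \<open>e\<close> of the tensor. Its inner product with
  \<open>ten x y\<close> is the mean of a product of two scalar functionals, one of \<open>f\<close>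
  and one of \<open>g\<close>, so the scalar notion of being uncorrelated applies.\<close>

lemma (in prob_space) uncorrelated_mean_tensor:
  fixes f :: "'a \<Rightarrow> 'x::real_normed_vector" and g :: "'a \<Rightarrow> 'y::real_normed_vector"
  assumes ten: "hilbert_tensor_product ten"
    and T: "bounded_linear T" and S: "bounded_linear S"
    and f: "has_bochner_mean M f 0" "AE \<omega> in M. norm (T (f \<omega>)) \<le> c"
    and g: "has_bochner_mean M g 0" "AE \<omega> in M. norm (S (g \<omega>)) \<le> d"
    and uncorr: "uncorrelated M f g"
  shows "has_bochner_mean M (\<lambda>\<omega>. ten (T (f \<omega>)) (S (g \<omega>))) 0"
proof -
  have sm: "strongly_measurable M (\<lambda>\<omega>. ten (T (f \<omega>)) (S (g \<omega>)))"
    using f(1) g(1) unfolding has_bochner_mean_def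
    by (intro strongly_measurable_bounded_bilinear[OF _ _
          hilbert_tensor_product_bounded_bilinear[OF ten]]
        strongly_measurable_bounded_linear[OF _ T] strongly_measurable_bounded_linear[OF _ S]) auto
  have "AE \<omega> in M. norm (ten (T (f \<omega>)) (S (g \<omega>))) \<le> c * d"
    using f(2) g(2)
  proof eventually_elim
    case (elim \<omega>)
    then show ?case
      unfolding hilbert_tensor_product_norm[OF ten]
      by (intro mult_mono) (auto intro: order_trans[OF norm_ge_zero])
  qed
  from has_bochner_mean_bounded[OF sm this] obtain e
    where e: "has_bochner_mean M (\<lambda>\<omega>. ten (T (f \<omega>)) (S (g \<omega>))) e" by blast
  have "inner e (ten x y) = 0" for x y
  proof (rule has_bochner_mean_unique)
    show "has_bochner_mean M (\<lambda>\<omega>. inner (ten (T (f \<omega>)) (S (g \<omega>))) (ten x y)) (inner e (ten x y))"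
      by (rule has_bochner_mean_bounded_linear[OF bounded_linear_inner_left e])
    \<comment> \<open>By the product rule for inner products of elementary tensors, testing against
      \<open>ten x y\<close> amounts to testing \<open>f\<close> with \<open>\<phi>\<close> and
      \<open>g\<close> with \<open>\<psi>\<close>. Both variables are centered, so the means
      subtracted in \<open>uncorrelated\<close> vanish.\<close>
    define \<phi> where "\<phi> = Blinfun (\<lambda>v. inner (T v) x)"
    define \<psi> where "\<psi> = Blinfun (\<lambda>v. inner (S v) y)"
    have \<phi>: "blinfun_apply \<phi> v = inner (T v) x" for v
      unfolding \<phi>_def using bounded_linear_compose[OF bounded_linear_inner_left T]
      by (simp add: bounded_linear_Blinfun_apply)
    have \<psi>: "blinfun_apply \<psi> v = inner (S v) y" for v
      unfolding \<psi>_def using bounded_linear_compose[OF bounded_linear_inner_left S]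
      by (simp add: bounded_linear_Blinfun_apply)
    have "has_bochner_mean M (\<lambda>\<omega>. blinfun_apply \<phi> (f \<omega>) * blinfun_apply \<psi> (g \<omega>)) 0"
      using uncorr unfolding uncorrelated_def bochner_mean_eqI[OF f(1)] bochner_mean_eqI[OF g(1)]
      by simp
    then show "has_bochner_mean M (\<lambda>\<omega>. inner (ten (T (f \<omega>)) (S (g \<omega>))) (ten x y)) 0"
      unfolding \<phi> \<psi> using ten unfolding hilbert_tensor_product_def by simp
  qed
  with e show ?thesis
    using hilbert_tensor_product_eq_0[OF ten] by blast
qed

text \<open>The filter \<open>nhds\<close> includes the origin itself, so the bound is asked for
  there too; for positive \<open>n\<close> it forces \<open>f 0 0\<close> to vanish.\<close>

lemma bigo_nhds_00I:
  fixes f :: "real \<Rightarrow> real \<Rightarrow> 'z::real_normed_vector"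
  assumes "0 < \<delta>"
    and le: "\<And>\<alpha> \<beta>. \<bar>\<alpha>\<bar> + \<bar>\<beta>\<bar> < \<delta> \<Longrightarrow> norm (f \<alpha> \<beta>) \<le> c * (\<bar>\<alpha>\<bar> + \<bar>\<beta>\<bar>) ^ n"
  shows "(\<lambda>(\<alpha>, \<beta>). norm (f \<alpha> \<beta>)) \<in> O[nhds (0, 0)](\<lambda>(\<alpha>, \<beta>). (\<bar>\<alpha>\<bar> + \<bar>\<beta>\<bar>) ^ n)"
proof (rule bigoI[where c = c])
  have "((\<lambda>t::real \<times> real. \<bar>fst t\<bar> + \<bar>snd t\<bar>) \<longlongrightarrow> \<bar>fst (0, 0::real)\<bar> + \<bar>snd (0::real, 0)\<bar>) (nhds (0, 0))"
    by (intro tendsto_intros filterlim_ident)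
  then have "\<forall>\<^sub>F t::real \<times> real in nhds (0, 0). \<bar>fst t\<bar> + \<bar>snd t\<bar> < \<delta>"
    using \<open>0 < \<delta>\<close> by (intro order_tendstoD(2)) auto
  then show "\<forall>\<^sub>F t in nhds (0, 0). norm (case t of (\<alpha>, \<beta>) \<Rightarrow> norm (f \<alpha> \<beta>))
      \<le> c * norm (case t of (\<alpha>, \<beta>) \<Rightarrow> (\<bar>\<alpha>\<bar> + \<bar>\<beta>\<bar>) ^ n)"
    by eventually_elim (auto simp: le)
qed

text \<open>Formulated for an arbitrary analytic map into a Hilbert space because it is applied to
  the eigenbasis and to the eigenvalue matrix alike. Both estimates are proved for all small
  parameters with constants independent of them.\<close>

lemma (in prob_space) random_perturbation_moments:
  fixes g :: "'x::banach \<times> 'y::banach \<Rightarrow> 'z::{real_inner,banach}"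
  assumes N: "open N" "p\<^sub>0 \<in> N" and g: "real_analytic_on g N"
    and \<mu>: "has_bochner_mean M \<mu>\<^sub>1 0" "AE \<omega> in M. norm (\<mu>\<^sub>1 \<omega>) \<le> C\<mu>"
    and \<epsilon>: "has_bochner_mean M \<epsilon>\<^sub>1 0" "AE \<omega> in M. norm (\<epsilon>\<^sub>1 \<omega>) \<le> C\<epsilon>"
    and uncorr: "uncorrelated M \<mu>\<^sub>1 \<epsilon>\<^sub>1"
    and ten: "hilbert_tensor_product ten"
  defines "G \<equiv> \<lambda>t \<omega>. g (perturbed p\<^sub>0 \<mu>\<^sub>1 \<epsilon>\<^sub>1 t \<omega>)"
  defines "G\<^sub>\<alpha> \<equiv> \<lambda>\<omega>. directional_derivative (\<lambda>t. G t \<omega>) (0, 0) (1, 0)"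
    and "G\<^sub>\<beta> \<equiv> \<lambda>\<omega>. directional_derivative (\<lambda>t. G t \<omega>) (0, 0) (0, 1)"
  shows "(\<lambda>(\<alpha>, \<beta>). norm (bochner_mean M (G (\<alpha>, \<beta>)) - g p\<^sub>0))
      \<in> O[nhds (0, 0)](\<lambda>(\<alpha>, \<beta>). (\<bar>\<alpha>\<bar> + \<bar>\<beta>\<bar>) ^ 2)" (is ?mean)
    and "(\<lambda>(\<alpha>, \<beta>). norm (cov ten M (G (\<alpha>, \<beta>)) (G (\<alpha>, \<beta>))
        - (\<alpha>\<^sup>2 *\<^sub>R cov ten M G\<^sub>\<alpha> G\<^sub>\<alpha> + \<beta>\<^sup>2 *\<^sub>R cov ten M G\<^sub>\<beta> G\<^sub>\<beta>)))
      \<in> O[nhds (0, 0)](\<lambda>(\<alpha>, \<beta>). (\<bar>\<alpha>\<bar> + \<bar>\<beta>\<bar>) ^ 3)" (is ?cov)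
proof -
  have "real_analytic_at g p\<^sub>0"
    using g N(2) unfolding real_analytic_on_def by blast
  then obtain D K r where D: "bounded_linear D" and r: "0 < r" and K: "0 \<le> K"
    and taylor: "\<And>h. norm h < r \<Longrightarrow> norm (g (p\<^sub>0 + h) - g p\<^sub>0 - D h) \<le> K * (norm h)\<^sup>2"
    by (rule real_analytic_at_taylor1) blast
  interpret D: bounded_linear D by fact
  interpret ten: bounded_bilinear ten
    by (rule hilbert_tensor_product_bounded_bilinear[OF ten])
  obtain KD where KD: "\<And>h. norm (D h) \<le> norm h * KD" "0 \<le> KD"
    using D.nonneg_bounded by blast
  have C\<mu>: "0 \<le> C\<mu>" and C\<epsilon>: "0 \<le> C\<epsilon>"
    by (rule AE_norm_le_nonneg[OF \<mu>(2)], rule AE_norm_le_nonneg[OF \<epsilon>(2)])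
  have sm: "strongly_measurable M \<mu>\<^sub>1" "strongly_measurable M \<epsilon>\<^sub>1"
    using \<mu>(1) \<epsilon>(1) unfolding has_bochner_mean_def by auto
  \<comment> \<open>\<open>T\<close> and \<open>S\<close> are the partial differentials of
    \<open>g\<close> in the two parameters. \<open>U\<close> and \<open>W\<close> below are the
    first order responses, which turn out to be the directional derivatives.\<close>
  define T where "T x = D (x, 0)" for x
  define S where "S y = D (0, y)" for y
  have T: "bounded_linear T" and S: "bounded_linear S"
    unfolding T_def S_def
    by (intro bounded_linear_compose[OF D] bounded_linear_intros)+
  define U where "U \<omega> = T (\<mu>\<^sub>1 \<omega>)" for \<omega>
  define W where "W \<omega> = S (\<epsilon>\<^sub>1 \<omega>)" for \<omega>
  \<comment> \<open>One constant above both coefficient bounds, so that the random increment has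
    norm at most \<open>c * (\<bar>\<alpha>\<bar> + \<bar>\<beta>\<bar>)\<close>.\<close>
  define c where "c = C\<mu> + C\<epsilon>"
  have U_le: "AE \<omega> in M. norm (U \<omega>) \<le> c * KD"
    using \<mu>(2)
  proof eventually_elim
    case (elim \<omega>)
    then have "norm (\<mu>\<^sub>1 \<omega>) * KD \<le> c * KD"
      unfolding c_def using C\<epsilon> KD by (intro mult_right_mono) auto
    then show ?case
      using KD(1)[of "(\<mu>\<^sub>1 \<omega>, 0)"] unfolding U_def T_def by simp
  qed
  have W_le: "AE \<omega> in M. norm (W \<omega>) \<le> c * KD"
    using \<epsilon>(2)
  proof eventually_elim
    case (elim \<omega>)
    then have "norm (\<epsilon>\<^sub>1 \<omega>) * KD \<le> c * KD"
      unfolding c_def using C\<mu> KD by (intro mult_right_mono) auto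
    then show ?case
      using KD(1)[of "(0, \<epsilon>\<^sub>1 \<omega>)"] unfolding W_def S_def by simp
  qed
  have U_sm: "strongly_measurable M U" and W_sm: "strongly_measurable M W"
    unfolding U_def W_def
    by (rule strongly_measurable_bounded_linear[OF sm(1) T]
        strongly_measurable_bounded_linear[OF sm(2) S])+
  have U_mean: "has_bochner_mean M U 0" and W_mean: "has_bochner_mean M W 0"
    using has_bochner_mean_bounded_linear[OF T \<mu>(1)] has_bochner_mean_bounded_linear[OF S \<epsilon>(1)]
    unfolding U_def W_def by (simp_all add: linear_0 bounded_linear.linear T S)
  have UW_mean: "has_bochner_mean M (\<lambda>\<omega>. ten (U \<omega>) (W \<omega>)) 0"
    using uncorrelated_mean_tensor[OF ten T S \<mu>(1) _ \<epsilon>(1) _ uncorr] U_le W_le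
    unfolding U_def W_def by blast
  have WU_mean: "has_bochner_mean M (\<lambda>\<omega>. ten (W \<omega>) (U \<omega>)) 0"
    using uncorrelated_mean_tensor[OF ten S T \<epsilon>(1) _ \<mu>(1) _ uncorrelated_sym[OF uncorr]] U_le W_le
    unfolding U_def W_def by blast
  have sq_le: "AE \<omega> in M. norm (ten (Z \<omega>) (Z \<omega>)) \<le> d * d"
    if "AE \<omega> in M. norm (Z \<omega>) \<le> d" for Z d
    using that
    by eventually_elim
      (auto simp: hilbert_tensor_product_norm[OF ten] power2_eq_square[symmetric]
        intro!: power_mono)
  \<comment> \<open>\<open>U\<close> and \<open>W\<close> have mean zero, so the centering inside
    \<open>cov\<close> disappears; the means exist by the almost sure bounds.\<close>
  have UU_mean: "has_bochner_mean M (\<lambda>\<omega>. ten (U \<omega>) (U \<omega>)) (cov ten M U U)"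
    and WW_mean: "has_bochner_mean M (\<lambda>\<omega>. ten (W \<omega>) (W \<omega>)) (cov ten M W W)"
    using has_bochner_mean_bounded[OF strongly_measurable_bounded_bilinear[OF U_sm U_sm
          ten.bounded_bilinear_axioms] sq_le[OF U_le]]
      has_bochner_mean_bounded[OF strongly_measurable_bounded_bilinear[OF W_sm W_sm
          ten.bounded_bilinear_axioms] sq_le[OF W_le]]
    unfolding cov_def bochner_mean_eqI[OF U_mean] bochner_mean_eqI[OF W_mean] by simp_all
  \<comment> \<open>Chain rule along the line through the reference parameter. A derivative at 0
    sees only small \<open>t\<close>, so the formula holds for every \<open>\<omega>\<close> and
    identifies the derivatives with \<open>U\<close> and \<open>W\<close> as functions.\<close>
  have deriv: "directional_derivative (\<lambda>t. G t \<omega>) (0, 0) d = D (fst d *\<^sub>R \<mu>\<^sub>1 \<omega>, snd d *\<^sub>R \<epsilon>\<^sub>1 \<omega>)"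
    for \<omega> d
  proof -
    define h where "h = (fst d *\<^sub>R \<mu>\<^sub>1 \<omega>, snd d *\<^sub>R \<epsilon>\<^sub>1 \<omega>)"
    have "(g has_derivative D) (at (p\<^sub>0 + 0 *\<^sub>R h))"
      using has_derivative_if_quadratic_remainder[OF D r taylor] by simp
    moreover have "((\<lambda>t. p\<^sub>0 + t *\<^sub>R h) has_vector_derivative h) (at 0)"
      by (auto intro!: derivative_eq_intros)
    ultimately have "((\<lambda>t. g (p\<^sub>0 + t *\<^sub>R h)) has_vector_derivative D h) (at 0)"
      using vector_derivative_diff_chain_within[of "\<lambda>t. p\<^sub>0 + t *\<^sub>R h" h 0 UNIV g D]
      by (simp add: o_def has_derivative_at_withinI)
    moreover have "g (p\<^sub>0 + t *\<^sub>R h) = G ((0, 0) + t *\<^sub>R d) \<omega>" for t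
      unfolding G_def perturbed_def h_def by (simp add: plus_prod_def)
    ultimately show ?thesis
      unfolding directional_derivative_def h_def by (simp add: vector_derivative_at)
  qed
  have G\<^sub>\<alpha>: "G\<^sub>\<alpha> = U" and G\<^sub>\<beta>: "G\<^sub>\<beta> = W"
    unfolding G\<^sub>\<alpha>_def G\<^sub>\<beta>_def deriv U_def W_def T_def S_def by simp_all
  \<comment> \<open>Radius at most \<open>r\<close> for the Taylor estimate, and a ball inside
    \<open>N\<close> for continuity of \<open>g\<close>, hence measurability of the perturbed
    quantity.\<close>
  obtain \<rho> where \<rho>: "0 < \<rho>" "\<rho> \<le> r" "ball p\<^sub>0 \<rho> \<subseteq> N"
  proof -
    obtain e where "0 < e" "ball p\<^sub>0 e \<subseteq> N"
      using N open_contains_ball by blast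
    with r show thesis
      by (intro that[of "min e r"]) auto
  qed
  have c: "0 \<le> c"
    unfolding c_def using C\<mu> C\<epsilon> by simp
  \<comment> \<open>The bound 1 later absorbs a fourth power into a third. The denominator
    \<open>c + 1\<close> stays positive when \<open>c\<close> is 0 and keeps the increment inside
    the ball of radius \<open>\<rho>\<close>.\<close>
  define \<delta> where "\<delta> = min 1 (\<rho> / (c + 1))"
  have \<delta>: "0 < \<delta>"
    unfolding \<delta>_def using \<rho> c by simp
  define k where "k = K * c\<^sup>2"
  have k: "0 \<le> k"
    unfolding k_def using K by simp
  \<comment> \<open>Origin of the constants: the remainder is at most
    \<open>K * (c * \<tau>)\<^sup>2 = k * \<tau>\<^sup>2\<close>, and centering it costs a factor 2.
    Two mixed products of \<open>c * KD * \<tau>\<close> with \<open>2 * k * \<tau>\<^sup>2\<close>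
    give the first summand. The square of the centered remainder gives
    \<open>4 * k\<^sup>2 * \<tau> ^ 4\<close>, which is reduced to a third power by
    \<open>\<tau> \<le> 1\<close>.\<close>
  have main: "norm (bochner_mean M (G (\<alpha>, \<beta>)) - g p\<^sub>0) \<le> k * (\<bar>\<alpha>\<bar> + \<bar>\<beta>\<bar>)\<^sup>2
      \<and> norm (cov ten M (G (\<alpha>, \<beta>)) (G (\<alpha>, \<beta>)) - (\<alpha>\<^sup>2 *\<^sub>R cov ten M U U + \<beta>\<^sup>2 *\<^sub>R cov ten M W W))
        \<le> (4 * (c * KD) * k + 4 * k\<^sup>2) * (\<bar>\<alpha>\<bar> + \<bar>\<beta>\<bar>) ^ 3"
    if small: "\<bar>\<alpha>\<bar> + \<bar>\<beta>\<bar> < \<delta>" for \<alpha> \<beta>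
  proof -
    define \<tau> where "\<tau> = \<bar>\<alpha>\<bar> + \<bar>\<beta>\<bar>"
    have \<tau>: "0 \<le> \<tau>" "\<tau> \<le> 1" "c * \<tau> < \<rho>"
    proof -
      show "0 \<le> \<tau>" "\<tau> \<le> 1"
        using small unfolding \<tau>_def \<delta>_def by auto
      have "\<tau> < \<rho> / (c + 1)"
        using small unfolding \<tau>_def \<delta>_def by auto
      then have "\<tau> * (c + 1) < \<rho>"
        using c by (simp add: pos_less_divide_eq)
      then show "c * \<tau> < \<rho>"
        using \<open>0 \<le> \<tau>\<close> by (simp add: algebra_simps)
    qed
    define h where "h \<omega> = (\<alpha> *\<^sub>R \<mu>\<^sub>1 \<omega>, \<beta> *\<^sub>R \<epsilon>\<^sub>1 \<omega>)" for \<omega>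
    have G: "G (\<alpha>, \<beta>) \<omega> = g (p\<^sub>0 + h \<omega>)" for \<omega>
      unfolding G_def perturbed_def h_def by (simp add: plus_prod_def)
    have h_le: "AE \<omega> in M. norm (h \<omega>) \<le> c * \<tau>"
      using \<mu>(2) \<epsilon>(2)
    proof eventually_elim
      case (elim \<omega>)
      have "norm (h \<omega>) \<le> \<bar>\<alpha>\<bar> * norm (\<mu>\<^sub>1 \<omega>) + \<bar>\<beta>\<bar> * norm (\<epsilon>\<^sub>1 \<omega>)"
        unfolding h_def using norm_Pair_le[of "\<alpha> *\<^sub>R \<mu>\<^sub>1 \<omega>" "\<beta> *\<^sub>R \<epsilon>\<^sub>1 \<omega>"] by simp
      also have "\<dots> \<le> \<bar>\<alpha>\<bar> * c + \<bar>\<beta>\<bar> * c"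
        using elim C\<mu> C\<epsilon> unfolding c_def by (intro add_mono mult_left_mono) auto
      finally show ?case
        unfolding \<tau>_def by (simp add: algebra_simps)
    qed
    have h_sm: "strongly_measurable M h"
      unfolding h_def
      by (intro strongly_measurable_Pair sm
          strongly_measurable_bounded_linear[OF _ bounded_linear_scaleR_right])
    have G_sm: "strongly_measurable M (G (\<alpha>, \<beta>))"
    proof -
      have "AE \<omega> in M. isCont g (p\<^sub>0 + h \<omega>)"
        using h_le
      proof eventually_elim
        case (elim \<omega>)
        then have "p\<^sub>0 + h \<omega> \<in> N"
          using \<tau>(3) \<rho>(3) by (auto simp: dist_norm)
        then show ?case
          using g unfolding real_analytic_on_def by (blast intro: real_analytic_at_isCont)
      qed
      then have "strongly_measurable M (\<lambda>\<omega>. g (p\<^sub>0 + h \<omega>))"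
        by (intro strongly_measurable_compose[where F = g] strongly_measurable_add
            strongly_measurable_const h_sm)
      then show ?thesis
        using G by presburger
    qed
    define Y where "Y \<omega> = \<alpha> *\<^sub>R U \<omega> + \<beta> *\<^sub>R W \<omega>" for \<omega>
    define R where "R \<omega> = G (\<alpha>, \<beta>) \<omega> - g p\<^sub>0 - Y \<omega>" for \<omega>
    have Y: "Y \<omega> = D (h \<omega>)" for \<omega>
      unfolding Y_def U_def W_def T_def S_def h_def
      by (simp flip: D.scaleR D.add)
    have Y_sm: "strongly_measurable M Y"
      unfolding Y_def
      by (intro strongly_measurable_add U_sm W_sm
          strongly_measurable_bounded_linear[OF _ bounded_linear_scaleR_right])
    have Y_le: "AE \<omega> in M. norm (Y \<omega>) \<le> c * KD * \<tau>"
      using h_le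
    proof eventually_elim
      case (elim \<omega>)
      then have "norm (h \<omega>) * KD \<le> c * \<tau> * KD"
        using KD by (intro mult_right_mono)
      with KD(1)[of "h \<omega>"] show ?case
        unfolding Y by (simp add: mult_ac)
    qed
    have Y_mean: "has_bochner_mean M Y 0"
      using has_bochner_mean_add[OF
          has_bochner_mean_bounded_linear[OF bounded_linear_scaleR_right U_mean, of \<alpha>]
          has_bochner_mean_bounded_linear[OF bounded_linear_scaleR_right W_mean, of \<beta>]]
      unfolding Y_def by simp
    have R_sm: "strongly_measurable M R"
      unfolding R_def by (intro strongly_measurable_diff G_sm strongly_measurable_const Y_sm)
    have R_le: "AE \<omega> in M. norm (R \<omega>) \<le> k * \<tau>\<^sup>2"
      using h_le
    proof eventually_elim
      case (elim \<omega>)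
      have "norm (R \<omega>) \<le> K * (norm (h \<omega>))\<^sup>2"
        unfolding R_def G Y using elim \<tau>(3) \<rho>(2) by (intro taylor) simp
      also have "\<dots> \<le> K * (c * \<tau>)\<^sup>2"
        using elim K by (intro mult_left_mono power_mono) auto
      finally show ?case
        unfolding k_def by (simp add: power_mult_distrib mult.assoc)
    qed
    \<comment> \<open>Since the linear part has mean zero, \<open>e\<close> is exactly the deviation
      of the expectation from the reference value; its bound is the first claim.\<close>
    define e where "e = bochner_mean M R"
    have R_mean: "has_bochner_mean M R e"
      unfolding e_def by (rule has_bochner_mean_bounded[OF R_sm R_le])
    have e_le: "norm e \<le> k * \<tau>\<^sup>2"
      by (rule has_bochner_mean_norm_le[OF R_mean R_le])
    have "has_bochner_mean M (G (\<alpha>, \<beta>)) (g p\<^sub>0 + e)"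
      by (rule has_bochner_mean_cong[OF has_bochner_mean_add[OF
              has_bochner_mean_const[of "g p\<^sub>0"] has_bochner_mean_add[OF Y_mean R_mean]]])
        (simp_all add: R_def)
    then have G_mean: "bochner_mean M (G (\<alpha>, \<beta>)) = g p\<^sub>0 + e"
      by (rule bochner_mean_eqI)
    \<comment> \<open>Subtracting the mean of the perturbed quantity leaves \<open>Y + R'\<close>,
      because \<open>Y\<close> is already centered.\<close>
    define R' where "R' \<omega> = R \<omega> - e" for \<omega>
    have R'_sm: "strongly_measurable M R'"
      unfolding R'_def by (intro strongly_measurable_diff R_sm strongly_measurable_const)
    have R'_le: "AE \<omega> in M. norm (R' \<omega>) \<le> 2 * k * \<tau>\<^sup>2"
      using R_le
    proof eventually_elim
      case (elim \<omega>)
      then show ?case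
        using norm_triangle_ineq4[of "R \<omega>" e] e_le unfolding R'_def by linarith
    qed
    \<comment> \<open>All products in the tensor square of \<open>Y + R'\<close> except that of
      \<open>Y\<close> with itself.\<close>
    define Q where "Q \<omega> = ten (Y \<omega>) (R' \<omega>) + (ten (R' \<omega>) (Y \<omega>) + ten (R' \<omega>) (R' \<omega>))" for \<omega>
    have Q_sm: "strongly_measurable M Q"
      unfolding Q_def
      by (intro strongly_measurable_add Y_sm R'_sm
          strongly_measurable_bounded_bilinear[OF _ _ ten.bounded_bilinear_axioms])
    have Q_le: "AE \<omega> in M. norm (Q \<omega>) \<le> (4 * (c * KD) * k + 4 * k\<^sup>2) * \<tau> ^ 3"
      using Y_le R'_le
    proof eventually_elim
      case (elim \<omega>)
      let ?y = "c * KD * \<tau>" and ?s = "2 * k * \<tau>\<^sup>2"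
      have s: "0 \<le> ?s"
        using k by simp
      have y: "0 \<le> ?y"
        using c KD(2) \<tau>(1) by simp
      have "norm (Q \<omega>) \<le> norm (ten (Y \<omega>) (R' \<omega>)) + (norm (ten (R' \<omega>) (Y \<omega>))
          + norm (ten (R' \<omega>) (R' \<omega>)))"
        unfolding Q_def by (intro norm_triangle_le add_left_mono norm_triangle_ineq)
      also have "\<dots> \<le> ?y * ?s + (?s * ?y + ?s * ?s)"
        unfolding hilbert_tensor_product_norm[OF ten]
        using elim s y by (intro add_mono mult_mono) auto
      also have "\<dots> = 4 * (c * KD) * k * \<tau> ^ 3 + 4 * k\<^sup>2 * (\<tau> ^ 3 * \<tau>)"
        by (simp add: power2_eq_square power3_eq_cube algebra_simps)
      also have "\<dots> \<le> 4 * (c * KD) * k * \<tau> ^ 3 + 4 * k\<^sup>2 * \<tau> ^ 3"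
        using \<tau> by (intro add_left_mono mult_left_mono mult_left_le) auto
      finally show ?case
        by (simp add: algebra_simps)
    qed
    define q where "q = bochner_mean M Q"
    have Q_mean: "has_bochner_mean M Q q"
      unfolding q_def by (rule has_bochner_mean_bounded[OF Q_sm Q_le])
    have q_le: "norm q \<le> (4 * (c * KD) * k + 4 * k\<^sup>2) * \<tau> ^ 3"
      by (rule has_bochner_mean_norm_le[OF Q_mean Q_le])
    note scale = has_bochner_mean_bounded_linear[OF bounded_linear_scaleR_right]
    \<comment> \<open>The tensor square is written as \<open>Q\<close>, the two pure second order
      terms and the two mixed ones. The means of the mixed terms are 0, so they drop out of the
      value in the closing simplification.\<close>
    have "has_bochner_mean M
        (\<lambda>\<omega>. ten (G (\<alpha>, \<beta>) \<omega> - (g p\<^sub>0 + e)) (G (\<alpha>, \<beta>) \<omega> - (g p\<^sub>0 + e)))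
        (q + (\<alpha>\<^sup>2 *\<^sub>R cov ten M U U + \<beta>\<^sup>2 *\<^sub>R cov ten M W W))"
    proof (rule has_bochner_mean_cong[OF has_bochner_mean_add[OF Q_mean has_bochner_mean_add[OF
              has_bochner_mean_add[OF scale[OF UU_mean, of "\<alpha>\<^sup>2"] scale[OF WW_mean, of "\<beta>\<^sup>2"]]
              has_bochner_mean_add[OF scale[OF UW_mean, of "\<alpha> * \<beta>"]
                scale[OF WU_mean, of "\<alpha> * \<beta>"]]]]])
      fix \<omega>
      have "G (\<alpha>, \<beta>) \<omega> - (g p\<^sub>0 + e) = Y \<omega> + R' \<omega>"
        unfolding R'_def R_def by simp
      moreover have "ten (Y \<omega>) (Y \<omega>) = \<alpha>\<^sup>2 *\<^sub>R ten (U \<omega>) (U \<omega>) + \<beta>\<^sup>2 *\<^sub>R ten (W \<omega>) (W \<omega>)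
          + ((\<alpha> * \<beta>) *\<^sub>R ten (U \<omega>) (W \<omega>) + (\<alpha> * \<beta>) *\<^sub>R ten (W \<omega>) (U \<omega>))"
        unfolding Y_def
        by (simp add: ten.add_left ten.add_right ten.scaleR_left ten.scaleR_right scaleR_add_right
            power2_eq_square mult.commute)
      ultimately show "Q \<omega> + (\<alpha>\<^sup>2 *\<^sub>R ten (U \<omega>) (U \<omega>) + \<beta>\<^sup>2 *\<^sub>R ten (W \<omega>) (W \<omega>)
          + ((\<alpha> * \<beta>) *\<^sub>R ten (U \<omega>) (W \<omega>) + (\<alpha> * \<beta>) *\<^sub>R ten (W \<omega>) (U \<omega>)))
        = ten (G (\<alpha>, \<beta>) \<omega> - (g p\<^sub>0 + e)) (G (\<alpha>, \<beta>) \<omega> - (g p\<^sub>0 + e))"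
        unfolding Q_def by (simp add: ten.add_left ten.add_right)
    qed simp
    then have "cov ten M (G (\<alpha>, \<beta>)) (G (\<alpha>, \<beta>))
        = q + (\<alpha>\<^sup>2 *\<^sub>R cov ten M U U + \<beta>\<^sup>2 *\<^sub>R cov ten M W W)"
      unfolding cov_def G_mean by (rule bochner_mean_eqI)
    then show ?thesis
      using e_le q_le unfolding G_mean \<tau>_def by simp
  qed
  show ?mean
    by (rule bigo_nhds_00I[OF \<delta>]) (use main in blast)
  show ?cov
    unfolding G\<^sub>\<alpha> G\<^sub>\<beta> by (rule bigo_nhds_00I[OF \<delta>]) (use main in blast)
qed

theorem theorem3p4:
  fixes \<iota> :: "'v::{real_inner,banach} \<Rightarrow>\<^sub>L 'h::{real_inner,banach}"
    and a :: "'x::banach \<Rightarrow>\<^sub>L 'v \<Rightarrow>\<^sub>L 'v \<Rightarrow>\<^sub>L real"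
    and b :: "'y::banach \<Rightarrow>\<^sub>L 'h \<Rightarrow>\<^sub>L 'h \<Rightarrow>\<^sub>L real"
    and P :: "'w measure"
    and \<mu>\<^sub>0 :: 'x and \<epsilon>\<^sub>0 :: 'y
    and \<mu>\<^sub>1 :: "'w \<Rightarrow> 'x" and \<epsilon>\<^sub>1 :: "'w \<Rightarrow> 'y"
    and C\<mu> C\<epsilon> \<alpha>\<^sub>0 \<beta>\<^sub>0 :: real
    and N :: "('x \<times> 'y) set"
    and l\<^sub>0 :: real and u\<^sub>0 :: "'v^'m"
    and u :: "'x \<times> 'y \<Rightarrow> 'v^'m" and L :: "'x \<times> 'y \<Rightarrow> real^'m^'m"
    and tenu :: "'v^'m \<Rightarrow> 'v^'m \<Rightarrow> 't::{real_inner,banach}"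
    and tenL :: "real^'m^'m \<Rightarrow> real^'m^'m \<Rightarrow> 's::{real_inner,banach}"
  defines "A \<equiv> \<lambda>\<mu>. bilinear_form (blinfun_apply a \<mu>)"
    and "B \<equiv> \<lambda>\<epsilon> v w. bilinear_form (blinfun_apply b \<epsilon>) (blinfun_apply \<iota> v) (blinfun_apply \<iota> w)"
    and "uR \<equiv> \<lambda>t \<omega>. u (perturbed (\<mu>\<^sub>0, \<epsilon>\<^sub>0) \<mu>\<^sub>1 \<epsilon>\<^sub>1 t \<omega>)"
    and "LR \<equiv> \<lambda>t \<omega>. L (perturbed (\<mu>\<^sub>0, \<epsilon>\<^sub>0) \<mu>\<^sub>1 \<epsilon>\<^sub>1 t \<omega>)"
    and "LR\<^sub>\<alpha> \<equiv> \<lambda>\<omega>. directional_derivative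
      (\<lambda>t. L (perturbed (\<mu>\<^sub>0, \<epsilon>\<^sub>0) \<mu>\<^sub>1 \<epsilon>\<^sub>1 t \<omega>)) (0, 0) (1, 0)"
    and "LR\<^sub>\<beta> \<equiv> \<lambda>\<omega>. directional_derivative
      (\<lambda>t. L (perturbed (\<mu>\<^sub>0, \<epsilon>\<^sub>0) \<mu>\<^sub>1 \<epsilon>\<^sub>1 t \<omega>)) (0, 0) (0, 1)"
    and "uR\<^sub>\<alpha> \<equiv> \<lambda>\<omega>. directional_derivative
      (\<lambda>t. u (perturbed (\<mu>\<^sub>0, \<epsilon>\<^sub>0) \<mu>\<^sub>1 \<epsilon>\<^sub>1 t \<omega>)) (0, 0) (1, 0)"
    and "uR\<^sub>\<beta> \<equiv> \<lambda>\<omega>. directional_derivative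
      (\<lambda>t. u (perturbed (\<mu>\<^sub>0, \<epsilon>\<^sub>0) \<mu>\<^sub>1 \<epsilon>\<^sub>1 t \<omega>)) (0, 0) (0, 1)"
  assumes embedding: "dense_compact_embedding \<iota>"
    and nbhd: "open N" "(\<mu>\<^sub>0, \<epsilon>\<^sub>0) \<in> N"
    and forms_a: "\<And>\<mu> \<epsilon>. (\<mu>, \<epsilon>) \<in> N \<Longrightarrow>
      symmetric_form (blinfun_apply a \<mu>) \<and> elliptic_form (blinfun_apply a \<mu>)"
    and forms_b: "\<And>\<mu> \<epsilon>. (\<mu>, \<epsilon>) \<in> N \<Longrightarrow>
      symmetric_form (blinfun_apply b \<epsilon>) \<and> elliptic_form (blinfun_apply b \<epsilon>)"
    and eigval: "eigenvalue (A \<mu>\<^sub>0) (B \<epsilon>\<^sub>0) l\<^sub>0"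
    and multiplicity: "dim (eigenspace (A \<mu>\<^sub>0) (B \<epsilon>\<^sub>0) l\<^sub>0) = CARD('m)"
    and eigbasis: "orthonormal_eigenbasis (A \<mu>\<^sub>0) (B \<epsilon>\<^sub>0) l\<^sub>0 u\<^sub>0"
    and analytic: "real_analytic_on (\<lambda>p. (u p, L p)) N"
    and eigenpairs: "\<And>\<mu> \<epsilon>. (\<mu>, \<epsilon>) \<in> N \<Longrightarrow>
      block_eigenpair (A \<mu>) (B \<epsilon>) (u (\<mu>, \<epsilon>)) (L (\<mu>, \<epsilon>))"
    and initial: "u (\<mu>\<^sub>0, \<epsilon>\<^sub>0) = u\<^sub>0" "L (\<mu>\<^sub>0, \<epsilon>\<^sub>0) = mat l\<^sub>0"
    and prob: "prob_space P"
    and L2: "in_L2 P \<mu>\<^sub>1" "in_L2 P \<epsilon>\<^sub>1"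
    and cent: "centered P \<mu>\<^sub>1" "centered P \<epsilon>\<^sub>1"
    and uncorr: "uncorrelated P \<mu>\<^sub>1 \<epsilon>\<^sub>1"
    and bounded: "AE \<omega> in P. norm (\<mu>\<^sub>1 \<omega>) \<le> C\<mu>" "AE \<omega> in P. norm (\<epsilon>\<^sub>1 \<omega>) \<le> C\<epsilon>"
    and small: "0 < \<alpha>\<^sub>0" "0 < \<beta>\<^sub>0"
      "\<And>\<alpha> \<beta>. \<alpha> \<in> {-\<alpha>\<^sub>0<..<\<alpha>\<^sub>0} \<Longrightarrow> \<beta> \<in> {-\<beta>\<^sub>0<..<\<beta>\<^sub>0} \<Longrightarrow>
        AE \<omega> in P. perturbed (\<mu>\<^sub>0, \<epsilon>\<^sub>0) \<mu>\<^sub>1 \<epsilon>\<^sub>1 (\<alpha>, \<beta>) \<omega> \<in> N"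
    and tensor: "hilbert_tensor_product tenu" "hilbert_tensor_product tenL"
  shows "(\<lambda>(\<alpha>, \<beta>). norm (bochner_mean P (LR (\<alpha>, \<beta>)) - mat l\<^sub>0))
        \<in> O[nhds (0, 0)](\<lambda>(\<alpha>, \<beta>). (\<bar>\<alpha>\<bar> + \<bar>\<beta>\<bar>) ^ 2)
    \<and> (\<lambda>(\<alpha>, \<beta>). norm (bochner_mean P (uR (\<alpha>, \<beta>)) - u\<^sub>0))
        \<in> O[nhds (0, 0)](\<lambda>(\<alpha>, \<beta>). (\<bar>\<alpha>\<bar> + \<bar>\<beta>\<bar>) ^ 2)
    \<and> (\<lambda>(\<alpha>, \<beta>). norm (cov tenL P (LR (\<alpha>, \<beta>)) (LR (\<alpha>, \<beta>))
          - (\<alpha>\<^sup>2 *\<^sub>R cov tenL P LR\<^sub>\<alpha> LR\<^sub>\<alpha> + \<beta>\<^sup>2 *\<^sub>R cov tenL P LR\<^sub>\<beta> LR\<^sub>\<beta>)))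
        \<in> O[nhds (0, 0)](\<lambda>(\<alpha>, \<beta>). (\<bar>\<alpha>\<bar> + \<bar>\<beta>\<bar>) ^ 3)
    \<and> (\<lambda>(\<alpha>, \<beta>). norm (cov tenu P (uR (\<alpha>, \<beta>)) (uR (\<alpha>, \<beta>))
          - (\<alpha>\<^sup>2 *\<^sub>R cov tenu P uR\<^sub>\<alpha> uR\<^sub>\<alpha> + \<beta>\<^sup>2 *\<^sub>R cov tenu P uR\<^sub>\<beta> uR\<^sub>\<beta>)))
        \<in> O[nhds (0, 0)](\<lambda>(\<alpha>, \<beta>). (\<bar>\<alpha>\<bar> + \<bar>\<beta>\<bar>) ^ 3)"
proof -
  interpret prob_space P
    by (rule prob)
  \<comment> \<open>The two components are projections of the jointly analytic pair. Tuples and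
    matrices form Hilbert spaces themselves, so the same moment expansion covers both.\<close>
  have u: "real_analytic_on u N" and L: "real_analytic_on L N"
    using analytic real_analytic_at_bounded_linear[OF bounded_linear_fst, of "\<lambda>p. (u p, L p)"]
      real_analytic_at_bounded_linear[OF bounded_linear_snd, of "\<lambda>p. (u p, L p)"]
    unfolding real_analytic_on_def by simp_all
  show ?thesis
    using random_perturbation_moments[OF nbhd L cent(1)[unfolded centered_def] bounded(1)
        cent(2)[unfolded centered_def] bounded(2) uncorr tensor(2)]
      random_perturbation_moments[OF nbhd u cent(1)[unfolded centered_def] bounded(1)
        cent(2)[unfolded centered_def] bounded(2) uncorr tensor(1)]
    unfolding LR_def uR_def LR\<^sub>\<alpha>_def LR\<^sub>\<beta>_def uR\<^sub>\<alpha>_def uR\<^sub>\<beta>_def initial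
    by blast
qed

end
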